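(* For any graph $G$, the following are equivalent: (a) $G$ is a $(2P_3,C_4,C_6,C_7,\text{3-pentagon})$-free graph that contains no simplicial vertices; (b) $G$ contains exactly one nontrivial anticomponent, and this anticomponent is a 5-crown; (c) $G$ can be obtained from a 5-crown by possibly adding universal vertices to it.
   Context: All graphs are finite, simple, nonnull. A graph is $(H_1,\dots,H_m)$-free if it has no induced subgraph isomorphic to any $H_i$. $P_k$, $C_k$ are the path and cycle on $k$ vertices; $2P_3$ is two disjoint copies of $P_3$. The 3-pentagon is the graph on vertices $a,b_1,b_2,b_3,c_1,c_2,c_3$ where $a$ is adjacent to each $b_i$ and to no $c_i$, $\{b_1,b_2,b_3\}$ is stable, $\{c_1,c_2,c_3\}$ is a clique, and $b_ic_j$ is an edge iff $i=j$. A clique is a possibly empty set of pairwise adjacent vertices. A vertex is simplicial if its neighbours form a clique, universal if adjacent to all other vertices. For disjoint vertex sets $X,Y$, $X$ is complete to $Y$ if every vertex of $X$ is adjacent to every vertex of $Y$. An anticomponent of $G$ is a maximal induced subgraph whose complement is connected; nontrivial if it has at least two vertices. "$G$ can be obtained from $Q$ by possibly adding universal vertices" means $Q$ is an induced subgraph of $G$ and $V(G)\setminus V(Q)$ is a (possibly empty) clique complete to $V(Q)$. A 5-ring is a graph $R$ whose vertex set partitions into nonempty sets $X_0,\dots,X_4$ (indices mod 5) such that each $X_i$ can be ordered $u^i_1,\dots,u^i_{|X_i|}$ with $X_i\subseteq N[u^i_{|X_i|}]\subseteq\dots\subseteq N[u^i_1]=X_{i-1}\cup X_i\cup X_{i+1}$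 (closed neighbourhoods in $R$). A 5-crown is a 5-ring with such a partition $(X_0,\dots,X_4)$ for which there is $i^*\in\mathbb{Z}_5$ with $X_{i^*-1}$ complete to $X_{i^*-2}$ and $X_{i^*+1}$ complete to $X_{i^*+2}$. *)

theory Defs
  imports Main
begin

type_synonym 'a graph = "'a set \<times> ('a \<Rightarrow> 'a \<Rightarrow> bool)"

definition is_graph :: "'a graph \<Rightarrow> bool" where
  "is_graph G \<longleftrightarrow> finite (fst G) \<and> fst G \<noteq> {} \<and>
     (\<forall>x y. snd G x y \<longrightarrow> x \<in> fst G \<and> y \<in> fst G) \<and>
     (\<forall>x. \<not> snd G x x) \<and> (\<forall>x y. snd G x y \<longrightarrow> snd G y x)"

definition induced :: "'a graph \<Rightarrow> 'a set \<Rightarrow> 'a graph" where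
  "induced G S = (S, \<lambda>x y. x \<in> S \<and> y \<in> S \<and> snd G x y)"

definition contains_induced :: "'a graph \<Rightarrow> 'b graph \<Rightarrow> bool" where
  "contains_induced G H \<longleftrightarrow> (\<exists>f. inj_on f (fst H) \<and> f ` fst H \<subseteq> fst G \<and>
     (\<forall>x\<in>fst H. \<forall>y\<in>fst H. snd G (f x) (f y) \<longleftrightarrow> snd H x y))"

definition free_of :: "'a graph \<Rightarrow> 'b graph \<Rightarrow> bool" where
  "free_of G H \<longleftrightarrow> \<not> contains_induced G H"

definition cycle_graph :: "nat \<Rightarrow> nat graph" where
  "cycle_graph k = ({0..<k}, \<lambda>i j. i < k \<and> j < k \<and> i \<noteq> j \<and>
       (Suc i mod k = j \<or> Suc j mod k = i))"

definition edges_graph :: "nat \<Rightarrow> (nat \<times> nat) set \<Rightarrow> nat graph" where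
  "edges_graph n F = ({0..<n}, \<lambda>i j. (i, j) \<in> F \<or> (j, i) \<in> F)"

definition two_P3 :: "nat graph" where
  "two_P3 = edges_graph 6 {(0,1),(1,2),(3,4),(4,5)}"

text \<open>3-pentagon: a = 0, b_i = i (i=1,2,3), c_i = i+3.\<close>
definition three_pentagon :: "nat graph" where
  "three_pentagon = edges_graph 7
     {(0,1),(0,2),(0,3),(4,5),(4,6),(5,6),(1,4),(2,5),(3,6)}"

definition is_clique :: "'a graph \<Rightarrow> 'a set \<Rightarrow> bool" where
  "is_clique G S \<longleftrightarrow> S \<subseteq> fst G \<and> (\<forall>x\<in>S. \<forall>y\<in>S. x \<noteq> y \<longrightarrow> snd G x y)"

definition nbrs :: "'a graph \<Rightarrow> 'a \<Rightarrow> 'a set" where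
  "nbrs G v = {u \<in> fst G. snd G v u}"

definition closed_nbrs :: "'a graph \<Rightarrow> 'a \<Rightarrow> 'a set" where
  "closed_nbrs G v = insert v (nbrs G v)"

definition simplicial :: "'a graph \<Rightarrow> 'a \<Rightarrow> bool" where
  "simplicial G v \<longleftrightarrow> v \<in> fst G \<and> is_clique G (nbrs G v)"

definition complete_to :: "'a graph \<Rightarrow> 'a set \<Rightarrow> 'a set \<Rightarrow> bool" where
  "complete_to G X Y \<longleftrightarrow> (\<forall>x\<in>X. \<forall>y\<in>Y. snd G x y)"

definition anticonnected :: "'a graph \<Rightarrow> 'a set \<Rightarrow> bool" where
  "anticonnected G S \<longleftrightarrow> S \<noteq> {} \<and> S \<subseteq> fst G \<and>
     (\<forall>x\<in>S. \<forall>y\<in>S. (\<lambda>u v. u \<in> S \<and> v \<in> S \<and> u \<noteq> v \<and> \<not> snd G u v)\<^sup>*\<^sup>* x y)"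

definition anticomponent :: "'a graph \<Rightarrow> 'a set \<Rightarrow> bool" where
  "anticomponent G S \<longleftrightarrow> anticonnected G S \<and>
     (\<forall>T. S \<subset> T \<and> T \<subseteq> fst G \<longrightarrow> \<not> anticonnected G T)"

definition nontrivial_anticomponent :: "'a graph \<Rightarrow> 'a set \<Rightarrow> bool" where
  "nontrivial_anticomponent G S \<longleftrightarrow> anticomponent G S \<and> card S \<ge> 2"

definition ring_partition :: "'a graph \<Rightarrow> (nat \<Rightarrow> 'a set) \<Rightarrow> bool" where
  "ring_partition R X \<longleftrightarrow>
     (\<forall>i<5. X i \<noteq> {}) \<and> (\<Union>i<5. X i) = fst R \<and>
     (\<forall>i<5. \<forall>j<5. i \<noteq> j \<longrightarrow> X i \<inter> X j = {}) \<and>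
     (\<forall>i<5. \<exists>us. distinct us \<and> set us = X i \<and>
        X i \<subseteq> closed_nbrs R (last us) \<and>
        (\<forall>j. Suc j < length us \<longrightarrow> closed_nbrs R (us ! Suc j) \<subseteq> closed_nbrs R (us ! j)) \<and>
        closed_nbrs R (hd us) = X ((i + 4) mod 5) \<union> X i \<union> X ((i + 1) mod 5))"

definition five_ring :: "'a graph \<Rightarrow> bool" where
  "five_ring R \<longleftrightarrow> (\<exists>X. ring_partition R X)"

definition five_crown :: "'a graph \<Rightarrow> bool" where
  "five_crown R \<longleftrightarrow> (\<exists>X i. i < 5 \<and> ring_partition R X \<and>
     complete_to R (X ((i + 4) mod 5)) (X ((i + 3) mod 5)) \<and>
     complete_to R (X ((i + 1) mod 5)) (X ((i + 2) mod 5)))"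

definition crown_plus_universal :: "'a graph \<Rightarrow> bool" where
  "crown_plus_universal G \<longleftrightarrow> (\<exists>Q. Q \<subseteq> fst G \<and> five_crown (induced G Q) \<and>
     is_clique G (fst G - Q) \<and> complete_to G (fst G - Q) Q)"

end

theory Submission
  imports Defs
begin

text \<open>
  For a 5-hole \<open>C\<close> of a free graph without simplicial vertices, let \<open>R\<close> be the set of vertices that
  see \<open>C\<close> as a vertex of \<open>C\<close> does (its three consecutive vertices) and \<open>U\<close> the set of vertices
  complete to \<open>C\<close>. Excluding \<open>C\<^sub>4\<close> and \<open>C\<^sub>6\<close> makes \<open>R\<close> a 5-ring and \<open>U\<close> a clique complete to it,
  and excluding \<open>2P\<^sub>3\<close> makes \<open>R\<close> a 5-crown. If \<open>C\<close> maximizes \<open>|R|\<close>, every vertex outside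
  \<open>R \<union> U\<close> attaches to a clique, these outer vertices induce a disjoint union of cliques, and within
  one such clique the neighbourhoods in \<open>R \<union> U\<close> are nested, so that a vertex with the smallest one
  is simplicial; thus there are no outer vertices. A 5-hole exists since otherwise the graph is
  chordal and Dirac's theorem yields a simplicial vertex.

  Conversely, adjacent vertices in one class of a ring have comparable closed neighbourhoods, so a
  hole or 3-pentagon has at most one vertex in each of the five classes, and a 5-crown is a union of
  three cliques, whereas \<open>2P\<^sub>3\<close> has a stable set of size four.
\<close>

section \<open>The ring around a 5-hole\<close>

text \<open>The exclusions are stated through adjacency alone, so that a forbidden configuration can
  be supplied vertex by vertex. Only \<open>no_C4\<close> and \<open>no_2P3\<close> ask for
  inequalities: in the other patterns two vertices are adjacent or told apart by a third that sees
  exactly one of them.\<close>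

locale free_graph =
  fixes V :: "'a set" and E :: "'a \<Rightarrow> 'a \<Rightarrow> bool"
  assumes fin: "finite V"
    and in_V: "E x y \<Longrightarrow> x \<in> V"
    and irrefl: "\<not> E x x"
    and sym: "E x y \<Longrightarrow> E y x"
    and no_C4: "\<lbrakk>E a b; E b c; E c d; E d a; \<not> E a c; \<not> E b d; a \<noteq> c; b \<noteq> d\<rbrakk> \<Longrightarrow> False"
    and no_C6: "\<lbrakk>E a b; E b c; E c d; E d e; E e f; E f a;
      \<not> E a c; \<not> E a d; \<not> E a e; \<not> E b d; \<not> E b e; \<not> E b f; \<not> E c e; \<not> E c f; \<not> E d f\<rbrakk> \<Longrightarrow> False"
    and no_C7: "\<lbrakk>E a b; E b c; E c d; E d e; E e f; E f g; E g a;
      \<not> E a c; \<not> E a d; \<not> E a e; \<not> E a f; \<not> E b d; \<not> E b e; \<not> E b f; \<not> E b g;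
      \<not> E c e; \<not> E c f; \<not> E c g; \<not> E d f; \<not> E d g; \<not> E e g\<rbrakk> \<Longrightarrow> False"
    and no_2P3: "\<lbrakk>E a b; E b c; a \<noteq> c; \<not> E a c; E d e; E e f; d \<noteq> f; \<not> E d f;
      \<not> E a d; \<not> E a e; \<not> E a f; \<not> E b d; \<not> E b e; \<not> E b f; \<not> E c d; \<not> E c e; \<not> E c f\<rbrakk> \<Longrightarrow> False"
    and no_3pentagon: "\<lbrakk>E a b1; E a b2; E a b3; E b1 c1; E b2 c2; E b3 c3; E c1 c2; E c1 c3; E c2 c3;
      \<not> E a c1; \<not> E a c2; \<not> E a c3; \<not> E b1 b2; \<not> E b1 b3; \<not> E b2 b3;
      \<not> E b1 c2; \<not> E b1 c3; \<not> E b2 c1; \<not> E b2 c3; \<not> E b3 c1; \<not> E b3 c2\<rbrakk> \<Longrightarrow> False"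
begin

definition c5 :: "'a \<Rightarrow> 'a \<Rightarrow> 'a \<Rightarrow> 'a \<Rightarrow> 'a \<Rightarrow> bool" where
  "c5 a b c d e \<longleftrightarrow> E a b \<and> E b c \<and> E c d \<and> E d e \<and> E e a \<and>
     \<not> E a c \<and> \<not> E a d \<and> \<not> E b d \<and> \<not> E b e \<and> \<not> E c e"

text \<open>The disjunct \<open>v = a\<close> puts \<open>a\<close> into its own class, so that the
  five classes cover the hole itself. They become the parts of the ring.\<close>

definition twins :: "'a \<Rightarrow> 'a \<Rightarrow> 'a \<Rightarrow> 'a \<Rightarrow> 'a \<Rightarrow> 'a set" where
  "twins a b c d e = {v. (v = a \<or> E v a) \<and> E v b \<and> E v e \<and> \<not> E v c \<and> \<not> E v d}"

definition ring :: "'a \<Rightarrow> 'a \<Rightarrow> 'a \<Rightarrow> 'a \<Rightarrow> 'a \<Rightarrow> 'a set" where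
  "ring a b c d e = twins a b c d e \<union> twins b c d e a \<union> twins c d e a b \<union>
     twins d e a b c \<union> twins e a b c d"

definition centres :: "'a \<Rightarrow> 'a \<Rightarrow> 'a \<Rightarrow> 'a \<Rightarrow> 'a \<Rightarrow> 'a set" where
  "centres a b c d e = {v. E v a \<and> E v b \<and> E v c \<and> E v d \<and> E v e}"

lemma c5_rot: "c5 a b c d e \<Longrightarrow> c5 b c d e a"
  unfolding c5_def using sym by blast

lemma c5_refl: "c5 a b c d e \<Longrightarrow> c5 a e d c b"
  unfolding c5_def using sym by blast

lemma twins_refl: "twins a e d c b = twins a b c d e"
  unfolding twins_def by blast

lemma ring_rot: "ring b c d e a = ring a b c d e"
  unfolding ring_def by blast

lemma ring_refl: "ring a e d c b = ring a b c d e"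
  unfolding ring_def twins_def by blast

lemma centres_rot: "centres b c d e a = centres a b c d e"
  unfolding centres_def by blast

lemma centres_refl: "centres a e d c b = centres a b c d e"
  unfolding centres_def by blast

text \<open>Nonadjacent \<open>u\<close> and \<open>v\<close> would form a C4 with the nonadjacent
  vertices \<open>b\<close> and \<open>e\<close>.\<close>

lemma twins_clique:
  assumes "c5 a b c d e" "u \<in> twins a b c d e" "v \<in> twins a b c d e" "u \<noteq> v"
  shows "E u v"
  using assms no_C4[of u b v e] sym irrefl unfolding c5_def twins_def mem_Collect_eq by metis

text \<open>An edge between \<open>u\<close> and \<open>v\<close> would close the C4
  \<open>u v d e\<close>.\<close>

lemma twins_anti:
  assumes "c5 a b c d e" "u \<in> twins a b c d e" "v \<in> twins c d e a b"
  shows "\<not> E u v"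
  using assms no_C4[of u v d e] sym irrefl unfolding c5_def twins_def mem_Collect_eq by metis

lemma twins_replace:
  assumes "c5 a b c d e" "u \<in> twins a b c d e"
  shows "c5 u b c d e"
  using assms sym unfolding c5_def twins_def mem_Collect_eq by blast

lemma twins_self: "c5 a b c d e \<Longrightarrow> a \<in> twins a b c d e"
  unfolding c5_def twins_def using sym by blast

lemma attach_consec:
  assumes "c5 a b c d e" "E v a" "E v c"
  shows "v = b \<or> E v b"
  using assms no_C4[of v a b c] sym irrefl unfolding c5_def by metis

text \<open>Private neighbours \<open>w\<close> and \<open>w'\<close> in one class are adjacent, so
  \<open>u w w' v\<close> would be a C4.\<close>

lemma twins_nested1:
  assumes "c5 a b c d e" "u \<in> twins a b c d e" "v \<in> twins a b c d e"
    "w \<in> twins b c d e a" "w' \<in> twins b c d e a" "E u w" "\<not> E v w" "E v w'"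
  shows "E u w'"
proof (rule ccontr)
  assume "\<not> E u w'"
  moreover have "E u v" using twins_clique assms calculation by metis
  moreover have "E w w'" using twins_clique[OF c5_rot[OF assms(1)]] assms calculation by metis
  moreover have "u \<noteq> w'" "w \<noteq> v"
    using assms(2-5) unfolding twins_def by blast+
  ultimately show False using no_C4[of u w w' v] assms(6-8) sym by metis
qed

text \<open>Private neighbours on opposite sides are joined through \<open>c\<close> and
  \<open>d\<close>, so \<open>u w c d w' v\<close> would be a C6.\<close>

lemma twins_nested2:
  assumes "c5 a b c d e" "u \<in> twins a b c d e" "v \<in> twins a b c d e"
    "w \<in> twins b c d e a" "w' \<in> twins e a b c d" "E u w" "\<not> E v w" "E v w'"
  shows "E u w'"
proof (rule ccontr)
  assume n: "\<not> E u w'"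
  have r: "c5 b c d e a" "c5 c d e a b" "c5 d e a b c" "c5 e a b c d"
    using assms(1) c5_rot by blast+
  have "E u v" using twins_clique assms n by metis
  moreover have "\<not> E w' w" using twins_anti[OF r(4)] assms by blast
  ultimately show False
    using no_C6[of u w c d w' v] assms(1-8) n sym unfolding c5_def twins_def mem_Collect_eq by metis
qed

text \<open>This is where excluding 2P3 forces a crown: nesting yields \<open>v\<close> and
  \<open>w\<close> in the two middle classes such that \<open>p0\<close>, \<open>v\<close>,
  \<open>w\<close>, \<open>r3\<close> are pairwise nonadjacent. Then \<open>p0 a v\<close> and
  \<open>w d r3\<close> form a 2P3.\<close>

lemma twins_three_incomplete:
  assumes "c5 a b c d e"
    and "p0 \<in> twins a b c d e" "p1 \<in> twins b c d e a" "\<not> E p0 p1"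
    and "q1 \<in> twins b c d e a" "q2 \<in> twins c d e a b" "\<not> E q1 q2"
    and "r2 \<in> twins c d e a b" "r3 \<in> twins d e a b c" "\<not> E r2 r3"
  shows False
proof -
  have r: "c5 b c d e a" "c5 c d e a b" "c5 d e a b c" "c5 e a b c d"
    using assms(1) c5_rot by blast+
  \<comment> \<open>Otherwise \<open>p1\<close> and \<open>q1\<close> would have private neighbours
    on opposite sides. So one of them misses both \<open>p0\<close> and \<open>q2\<close>.\<close>
  have "\<not> E p1 q2 \<or> \<not> E q1 p0"
    using twins_nested2[OF r(1) assms(3,5) assms(6,2)] assms sym by blast
  then obtain v where v: "v \<in> twins b c d e a" "\<not> E v p0" "\<not> E v q2"
    using assms sym by blast
  have "\<not> E q2 r3 \<or> \<not> E r2 v"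
    using twins_nested2[OF r(2) assms(6,8) assms(9) v(1)] assms v sym by blast
  then obtain w where w: "w \<in> twins c d e a b" "\<not> E w v" "\<not> E w r3"
    using assms v sym by blast
  have "\<not> E p0 w" "\<not> E v r3" "\<not> E r3 p0"
    using twins_anti assms(1,2,9) r v w by blast+
  then show False
    using no_2P3[of p0 a v w d r3] v w assms(1,2,9) sym irrefl
    unfolding c5_def twins_def mem_Collect_eq by metis
qed

lemma twins_centres:
  assumes "c5 a b c d e" "u \<in> twins a b c d e" "v \<in> centres a b c d e"
  shows "E u v"
  using assms no_C4[of u b v e] sym irrefl unfolding c5_def twins_def centres_def mem_Collect_eq by metis

lemma centres_clique:
  assumes "c5 a b c d e" "u \<in> centres a b c d e" "v \<in> centres a b c d e" "u \<noteq> v"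
  shows "E u v"
  using assms no_C4[of u a v c] sym irrefl unfolding c5_def centres_def mem_Collect_eq by metis

section \<open>Vertices outside a maximum ring\<close>

text \<open>Since \<open>p b q d e\<close> is again a 5-hole, \<open>attach_consec\<close> gives
  \<open>b\<close>. Seeing \<open>d\<close> or \<open>e\<close> would spread around the hole by the
  same lemma until \<open>v\<close> is a centre. A neighbour \<open>y\<close> in the class of
  \<open>d\<close> or \<open>e\<close> can take that vertex's place in a hole and again forces
  \<open>e\<close> or \<open>d\<close>.\<close>

lemma attach_two:
  assumes "c5 a b c d e" "v \<notin> ring a b c d e" "v \<notin> centres a b c d e"
    and "p \<in> twins a b c d e" "q \<in> twins c d e a b" "E v p" "E v q"
  shows "E v b" "\<not> E v d" "\<not> E v e"
    and "y \<in> twins d e a b c \<Longrightarrow> \<not> E v y" "y \<in> twins e a b c d \<Longrightarrow> \<not> E v y"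
proof -
  have r: "c5 b c d e a" "c5 c d e a b" "c5 d e a b c" "c5 e a b c d"
    using assms(1) c5_rot by blast+
  have ne: "v \<noteq> a" "v \<noteq> b" "v \<noteq> c" "v \<noteq> d" "v \<noteq> e"
    using assms(2) twins_self[OF assms(1)] twins_self[OF r(1)] twins_self[OF r(2)]
      twins_self[OF r(3)] twins_self[OF r(4)] unfolding ring_def by blast+
  have p: "c5 p b c d e" using twins_replace[OF assms(1,4)] .
  have q: "c5 q d e a b" using twins_replace[OF r(2) assms(5)] .
  have pq: "c5 p b q d e"
  proof -
    have "\<not> E p q" using twins_anti assms by blast
    then show ?thesis using p q unfolding c5_def using sym by blast
  qed
  show vb: "E v b" using attach_consec[OF pq] assms ne by blast
  have 1: "E v d \<Longrightarrow> E v e" using attach_consec[OF c5_rot[OF c5_rot[OF c5_rot[OF p]]], of v] assms ne by blast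
  have 2: "E v e \<Longrightarrow> E v d" using attach_consec[OF q, of v] assms ne by blast
  have 3: "E v e \<Longrightarrow> E v a" using attach_consec[OF r(4), of v] vb ne by blast
  have 4: "E v d \<Longrightarrow> E v c" using attach_consec[OF r(1), of v] vb ne by blast
  show d: "\<not> E v d" and e: "\<not> E v e"
    using 1 2 3 4 vb assms(3) unfolding centres_def by blast+
  show "\<not> E v y" if "y \<in> twins d e a b c"
  proof -
    have "c5 y e p b c" using twins_replace[OF c5_rot[OF c5_rot[OF c5_rot[OF p]]]] that
        twins_anti[OF r(3) that assms(4)] unfolding twins_def c5_def by blast
    then show ?thesis using attach_consec[of y e p b c v] assms ne e by blast
  qed
  show "\<not> E v y" if "y \<in> twins e a b c d"
  proof -
    have "c5 q d y a b" using twins_replace[OF r(4) that] q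
        twins_anti[OF r(2) assms(5) that] unfolding c5_def using sym by blast
    then show ?thesis using attach_consec[of q d y a b v] assms ne d by blast
  qed
qed

text \<open>Here the excluded 3-pentagon enters: its triangle is \<open>c, q, d\<close>, its centre is \<open>x\<close>
  and its stable set is \<open>w, v, e\<close>.\<close>

lemma attach_pentagon:
  assumes "c5 a b c d e" "q \<in> twins c d e a b" "x \<in> twins a b c d e" "w \<in> twins b c d e a"
    and "E v x" "E v q" "\<not> E v c" "\<not> E v d" "\<not> E v e" "E w x" "\<not> E w q" "\<not> E v w"
  shows False
proof -
  have "\<not> E x q" using twins_anti assms by blast
  moreover have "q \<noteq> c" using assms(6,7) by blast
  ultimately show False
    using no_3pentagon[of x w v e c q d] assms(1-12) sym
    unfolding c5_def twins_def mem_Collect_eq by metis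
qed

text \<open>A missed \<open>w\<close> shares no neighbours with \<open>v\<close> in both outer
  classes at once, by the C4 \<open>v p' w q'\<close>. With the 3-pentagon this sharpens until
  \<open>w\<close> misses \<open>p\<close> and \<open>q\<close> and \<open>v\<close> misses
  \<open>a\<close> and \<open>c\<close>; then \<open>v p a w c q\<close> is a C6.\<close>

lemma attach_two_complete:
  assumes "c5 a b c d e" "v \<notin> ring a b c d e" "v \<notin> centres a b c d e"
    and "p \<in> twins a b c d e" "q \<in> twins c d e a b" "E v p" "E v q" "w \<in> twins b c d e a"
  shows "E v w"
proof (rule ccontr)
  assume n: "\<not> E v w"
  have r: "c5 b c d e a" "c5 c d e a b" "c5 d e a b c" "c5 e a b c d"
    using assms(1) c5_rot by blast+
  note at = attach_two[OF assms(1-7)]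
  have vw: "v \<noteq> w" using assms unfolding ring_def by blast
  have C4: "\<not> E v p' \<or> \<not> E v q' \<or> \<not> E w p' \<or> \<not> E w q'"
    if "p' \<in> twins a b c d e" "q' \<in> twins c d e a b" for p' q'
  proof -
    have "\<not> E p' q'" "p' \<noteq> q'"
      using twins_anti[OF assms(1) that] that assms(1) unfolding twins_def c5_def by blast+
    then show ?thesis using no_C4[of v p' w q'] n vw sym by blast
  qed
  have wa: "E w a" "E w c" "\<not> E w d" "\<not> E w e" using assms(8) unfolding twins_def by blast+
  \<comment> \<open>A neighbour \<open>p'\<close> common to \<open>v\<close> and \<open>w\<close>
    forces \<open>v\<close> to miss \<open>c\<close>, and then \<open>q'\<close> completes a
    3-pentagon. \<open>L\<close> is the mirror image.\<close>
  have R: "\<not> E w p' \<or> \<not> E v p'" if "p' \<in> twins a b c d e" "\<not> E w q'" "q' \<in> twins c d e a b" "E v q'" for p' q'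
  proof (rule ccontr)
    assume "\<not> ?thesis"
    then have x: "E w p'" "E v p'" by blast+
    have "\<not> E v c" using C4[OF that(1) twins_self[OF r(2)]] x wa by blast
    then show False
      using attach_pentagon[OF assms(1) that(3) that(1) assms(8)] x that at n by blast
  qed
  have L: "\<not> E w q' \<or> \<not> E v q'" if "q' \<in> twins c d e a b" "\<not> E w p'" "p' \<in> twins a b c d e" "E v p'" for p' q'
  proof (rule ccontr)
    assume "\<not> ?thesis"
    then have x: "E w q'" "E v q'" by blast+
    have va: "\<not> E v a" using C4[OF twins_self[OF assms(1)] that(1)] x wa by blast
    have "c5 c b a e d" using c5_refl[OF r(2)] .
    moreover have "p' \<in> twins a e d c b" "q' \<in> twins c b a e d" "w \<in> twins b a e d c"
      using that assms(8) twins_refl by blast+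
    ultimately show False
      using attach_pentagon[of c b a e d p' q' w v] va x that at n by blast
  qed
  have "\<not> E w p \<or> \<not> E w q" using C4 assms by blast
  then have np: "\<not> E w p" "\<not> E w q" using R L assms by blast+
  then have nac: "\<not> E v a" "\<not> E v c"
    using R[OF twins_self[OF assms(1)] np(2)] L[OF twins_self[OF r(2)] np(1)] wa assms by blast+
  have "E p a" "E q c" using nac assms(4-7) unfolding twins_def by blast+
  moreover have "\<not> E p q" "\<not> E p c" "\<not> E a q"
    using twins_anti assms(1,4,5) twins_self r by blast+
  ultimately show False
    using no_C6[of v p a w c q] np nac n wa assms(1,6,7) sym unfolding c5_def by metis
qed

text \<open>Prepares the exchange of \<open>a\<close> for \<open>p\<close> in the hole without
  losing ring vertices. If \<open>p\<close> differs from \<open>a\<close>, then \<open>v\<close>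
  misses \<open>a\<close>, and a missed \<open>w\<close> or \<open>y\<close> would give the C4
  \<open>p a w v\<close> or the C6 \<open>y a p v q d\<close>.\<close>

lemma attach_two_swap:
  assumes "c5 a b c d e" "v \<notin> ring a b c d e" "v \<notin> centres a b c d e"
    and "p \<in> twins a b c d e" "q \<in> twins c d e a b" "E v p" "E v q" "p = a \<or> \<not> E v a"
  shows "w \<in> twins b c d e a \<Longrightarrow> E p w" "y \<in> twins e a b c d \<Longrightarrow> E p y"
proof -
  have r: "c5 b c d e a" "c5 c d e a b" "c5 d e a b c" "c5 e a b c d"
    using assms(1) c5_rot by blast+
  note at = attach_two[OF assms(1-7)]
  show "E p w" if w: "w \<in> twins b c d e a"
  proof (rule ccontr)
    assume n: "\<not> E p w"
    have wa: "E w a" using w unfolding twins_def by blast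
    then have "p \<noteq> a" using n sym by blast
    then have "E p a" "\<not> E v a" using assms(4,8) unfolding twins_def by blast+
    moreover have "E v w" using attach_two_complete[OF assms(1-7) w] .
    moreover have "p \<noteq> w" using assms(4) w unfolding twins_def by blast
    moreover have "a \<noteq> v" using assms(2) twins_self[OF assms(1)] unfolding ring_def by blast
    ultimately show False using no_C4[of p a w v] n wa assms(6) sym by metis
  qed
  show "E p y" if y: "y \<in> twins e a b c d"
  proof (rule ccontr)
    assume n: "\<not> E p y"
    have ya: "E y a" "E y d" using y unfolding twins_def by blast+
    then have "p \<noteq> a" using n sym by blast
    then have "E p a" "\<not> E v a" using assms(4,8) unfolding twins_def by blast+
    moreover have "\<not> E v y" using at(5)[OF y] .
    moreover have "\<not> E y q" "\<not> E p q" "\<not> E a q"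
      using twins_anti assms(1,4,5) twins_self r y sym by blast+
    moreover have "E q d" "\<not> E p d" using assms(4,5) unfolding twins_def by blast+
    ultimately show False
      using no_C6[of y a p v q d] n ya assms(1,6,7) at(2) sym unfolding c5_def by metis
  qed
qed

definition max_c5 :: "'a \<Rightarrow> 'a \<Rightarrow> 'a \<Rightarrow> 'a \<Rightarrow> 'a \<Rightarrow> bool" where
  "max_c5 a b c d e \<longleftrightarrow> c5 a b c d e \<and>
     (\<forall>a' b' c' d' e'. c5 a' b' c' d' e' \<longrightarrow> card (ring a' b' c' d' e') \<le> card (ring a b c d e))"

lemma ring_in_V: "ring a b c d e \<subseteq> V"
  unfolding ring_def twins_def using in_V by blast

lemma max_c5_exists:
  assumes "c5 a b c d e"
  shows "\<exists>a b c d e. max_c5 a b c d e"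
proof -
  let ?P = "\<lambda>(a, b, c, d, e). c5 a b c d e" and ?f = "\<lambda>(a, b, c, d, e). card (ring a b c d e)"
  have "?P (a, b, c, d, e)" using assms by simp
  moreover have "\<forall>y. ?P y \<longrightarrow> ?f y < Suc (card V)"
    using card_mono[OF fin ring_in_V] by (auto simp: less_Suc_eq_le)
  ultimately obtain x where "?P x" "\<forall>y. ?P y \<longrightarrow> ?f y \<le> ?f x"
    using ex_has_greatest_nat[of ?P "(a, b, c, d, e)" ?f "Suc (card V)"] by (auto simp: less_imp_le)
  then show ?thesis unfolding max_c5_def by (cases x) fastforce
qed

lemma max_c5_rot: "max_c5 a b c d e \<Longrightarrow> max_c5 b c d e a"
  unfolding max_c5_def using c5_rot ring_rot by metis

text \<open>If \<open>v\<close> saw both classes, replacing \<open>a\<close> and \<open>c\<close> by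
  suitable neighbours \<open>p'\<close> and \<open>q'\<close> of \<open>v\<close> would give a hole
  whose ring contains the old ring and also \<open>v\<close>, as a twin of \<open>b\<close>. This
  contradicts the maximality of the ring.\<close>

lemma outer_far:
  assumes m: "max_c5 a b c d e" and o: "v \<notin> ring a b c d e" "v \<notin> centres a b c d e"
    and p: "p \<in> twins a b c d e" and q: "q \<in> twins c d e a b" and vp: "E v p"
  shows "\<not> E v q"
proof
  assume vq: "E v q"
  have c: "c5 a b c d e" using m unfolding max_c5_def by blast
  have r: "c5 b c d e a" "c5 c d e a b" "c5 d e a b c" "c5 e a b c d"
    using c c5_rot by blast+
  \<comment> \<open>The vertex \<open>a\<close> itself is taken whenever \<open>v\<close> sees it,
    as \<open>attach_two_swap\<close> requires; likewise for \<open>q'\<close> and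
    \<open>c\<close>.\<close>
  obtain p' where p': "p' \<in> twins a b c d e" "E v p'" "p' = a \<or> \<not> E v a"
    using p vp twins_self[OF c] by blast
  obtain q' where q': "q' \<in> twins c d e a b" "E v q'" "q' = c \<or> \<not> E v c"
    using q vq twins_self[OF r(2)] by blast
  note at = attach_two[OF c o p'(1) q'(1) p'(2) q'(2)]
  note pc = attach_two_swap[OF c o p'(1) q'(1) p'(2) q'(2) p'(3)]
  \<comment> \<open>Reversing the hole around \<open>b\<close> exchanges \<open>a\<close> with
    \<open>c\<close> and \<open>e\<close> with \<open>d\<close>, so the facts about
    \<open>p'\<close> carry over to \<open>q'\<close>.\<close>
  have qc: "E q' w" if "w \<in> twins b c d e a" for w
    using attach_two_swap(1)[of c b a e d v q' p' w] c5_refl[OF r(2)] o p' q' that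
      ring_refl[of b a e d c] ring_rot centres_refl[of b a e d c] centres_rot twins_refl by metis
  have qd: "E q' w" if "w \<in> twins d e a b c" for w
    using attach_two_swap(2)[of c b a e d v q' p' w] c5_refl[OF r(2)] o p' q' that
      ring_refl[of b a e d c] ring_rot centres_refl[of b a e d c] centres_rot twins_refl by metis
  have "\<not> E p' q'" using twins_anti[OF c p'(1) q'(1)] .
  then have h: "c5 p' b q' d e"
    using c p'(1) q'(1) sym unfolding c5_def twins_def by blast
  have "twins a b c d e \<subseteq> twins p' b q' d e"
    using twins_clique[OF c _ p'(1)] twins_anti[OF c _ q'(1)] unfolding twins_def by blast
  moreover have "twins b c d e a \<subseteq> twins b q' d e p'"
    using pc(1) qc sym unfolding twins_def by blast
  moreover have "twins c d e a b \<subseteq> twins q' d e p' b"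
    using twins_clique[OF r(2) _ q'(1)] twins_anti[OF c p'(1)] sym unfolding twins_def by blast
  moreover have "twins d e a b c \<subseteq> twins d e p' b q'"
    using qd twins_anti[OF r(3) _ p'(1)] sym unfolding twins_def by blast
  moreover have "twins e a b c d \<subseteq> twins e p' b q' d"
    using pc(2) twins_anti[OF r(2) q'(1)] sym unfolding twins_def by blast
  ultimately have "ring a b c d e \<subseteq> ring p' b q' d e" unfolding ring_def by blast
  moreover have "v \<in> ring p' b q' d e"
    using at p' q' unfolding ring_def twins_def by blast
  ultimately have "ring a b c d e \<subset> ring p' b q' d e" using o by blast
  then have "card (ring a b c d e) < card (ring p' b q' d e)"
    by (rule psubset_card_mono[OF finite_subset[OF ring_in_V fin]])
  then show False using m h unfolding max_c5_def by (metis not_less)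
qed

text \<open>By \<open>outer_far\<close> the vertex \<open>v\<close> misses \<open>c\<close>,
  \<open>d\<close> and \<open>e\<close>, so nonadjacent \<open>p\<close> and \<open>q\<close> would
  give the C6 \<open>p v q c d e\<close>.\<close>

lemma outer_clique:
  assumes m: "max_c5 a b c d e" and o: "v \<notin> ring a b c d e" "v \<notin> centres a b c d e"
    and p: "p \<in> twins a b c d e" and q: "q \<in> twins b c d e a" and vp: "E v p" and vq: "E v q"
  shows "E p q"
proof (rule ccontr)
  assume n: "\<not> E p q"
  have c: "c5 a b c d e" using m unfolding max_c5_def by blast
  have r: "c5 b c d e a" "c5 c d e a b" "c5 d e a b c" "c5 e a b c d"
    using c c5_rot by blast+
  have o1: "v \<notin> ring b c d e a" "v \<notin> centres b c d e a"
    using o ring_rot centres_rot by metis+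
  have o3: "v \<notin> ring d e a b c" "v \<notin> centres d e a b c"
    using o ring_rot centres_rot by metis+
  have o4: "v \<notin> ring e a b c d" "v \<notin> centres e a b c d"
    using o ring_rot centres_rot by metis+
  have m1: "max_c5 b c d e a" and m3: "max_c5 d e a b c" and m4: "max_c5 e a b c d"
    using m max_c5_rot by blast+
  have "\<not> E v c" using outer_far[OF m o p twins_self[OF r(2)] vp] .
  moreover have "\<not> E v d" using outer_far[OF m3 o3 twins_self[OF r(3)] p] vp by blast
  moreover have "\<not> E v e" using outer_far[OF m4 o4 twins_self[OF r(4)] q] vq by blast
  ultimately show False
    using no_C6[of p v q c d e] n p q vp vq c sym unfolding c5_def twins_def mem_Collect_eq by metis
qed

text \<open>On a 5-hole the listed pairs are exactly the nonadjacent ones, so the neighbours of a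
  far vertex on the hole form a clique.\<close>

definition far :: "'a \<Rightarrow> 'a \<Rightarrow> 'a \<Rightarrow> 'a \<Rightarrow> 'a \<Rightarrow> 'a \<Rightarrow> bool" where
  "far a b c d e v \<longleftrightarrow> \<not> (E v a \<and> E v c) \<and> \<not> (E v b \<and> E v d) \<and> \<not> (E v c \<and> E v e) \<and>
     \<not> (E v d \<and> E v a) \<and> \<not> (E v e \<and> E v b)"

text \<open>Cases by who sees \<open>b\<close>. If both do, \<open>v w c d e a\<close> is a C6; if
  just one does, it lies on a C4 through \<open>b\<close>. If neither does, the edges from
  \<open>v\<close> to \<open>e\<close> and from \<open>w\<close> to \<open>d\<close> decide: both
  give the C4 \<open>v e d w\<close>, exactly one a 3-pentagon, none the C6 again.\<close>

lemma far_edge: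
  assumes c: "c5 a b c d e" and f: "far a b c d e v" "far a b c d e w" and vw: "E v w" and va: "E v a"
  shows "\<not> E w c"
proof
  assume wc: "E w c"
  have x: "\<not> E v c" "\<not> E v d" "\<not> E w a" "\<not> E w e" using f va wc unfolding far_def by blast+
  show False
  proof (cases "E v b")
    case vb: True
    then have ve: "\<not> E v e" using f(1) unfolding far_def by blast
    show False
    proof (cases "E w b")
      case True
      then have "\<not> E w d" using f(2) unfolding far_def by blast
      then show False using no_C6[of v w c d e a] ve x vw va wc c sym unfolding c5_def by metis
    next
      case False
      have "v \<noteq> c" "w \<noteq> b" using x va wc vb c sym unfolding c5_def by metis+
      then show False using no_C4[of v b c w] False vb x vw wc c sym unfolding c5_def by metis
    qed
  next
    case nvb: False
    show False
    proof (cases "E w b")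
      case True
      have "v \<noteq> b" "w \<noteq> a" using x va wc True c sym unfolding c5_def by metis+
      then show False using no_C4[of v a b w] True nvb x vw va c sym unfolding c5_def by metis
    next
      case nwb: False
      consider "E v e" "E w d" | "E v e" "\<not> E w d" | "\<not> E v e" "E w d" | "\<not> E v e" "\<not> E w d" by blast
      then show False
      proof cases
        case 1
        have "v \<noteq> d" "w \<noteq> e" using x va wc 1 c sym unfolding c5_def by metis+
        then show False using no_C4[of v e d w] 1 x vw c sym unfolding c5_def by metis
      next
        case 2
        then show False
          using no_3pentagon[of c w b d v a e] nvb nwb x vw va wc c sym unfolding c5_def by metis
      next
        case 3
        then show False
          using no_3pentagon[of a v b e w c d] nvb nwb x vw va wc c sym unfolding c5_def by metis
      next
        case 4
        then show False using no_C6[of v w c d e a] x vw va wc c sym unfolding c5_def by metis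
      qed
    qed
  qed
qed

definition outer :: "'a \<Rightarrow> 'a \<Rightarrow> 'a \<Rightarrow> 'a \<Rightarrow> 'a \<Rightarrow> 'a set" where
  "outer a b c d e = V - ring a b c d e - centres a b c d e"

lemma outer_rot: "outer b c d e a = outer a b c d e"
  unfolding outer_def using ring_rot centres_rot by metis

lemma outer_far':
  assumes "max_c5 a b c d e" "v \<in> outer a b c d e"
    and "p \<in> twins a b c d e" "q \<in> twins c d e a b"
  shows "\<not> (E v p \<and> E v q)"
  using outer_far[OF assms(1) _ _ assms(3,4)] assms(2) unfolding outer_def by blast

lemma max_c5_rots:
  assumes "max_c5 a b c d e"
  shows "max_c5 b c d e a" "max_c5 c d e a b" "max_c5 d e a b c" "max_c5 e a b c d"
    "c5 a b c d e" "c5 b c d e a" "c5 c d e a b" "c5 d e a b c" "c5 e a b c d"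
proof -
  show m: "max_c5 b c d e a" "max_c5 c d e a b" "max_c5 d e a b c" "max_c5 e a b c d"
    using assms max_c5_rot by blast+
  show "c5 a b c d e" "c5 b c d e a" "c5 c d e a b" "c5 d e a b c" "c5 e a b c d"
    using assms m unfolding max_c5_def by blast+
qed

lemma outer_rots:
  "outer b c d e a = outer a b c d e" "outer c d e a b = outer a b c d e"
  "outer d e a b c = outer a b c d e" "outer e a b c d = outer a b c d e"
  using outer_rot by metis+

lemma outer_mem_rots:
  assumes "v \<in> outer a b c d e"
  shows "v \<in> outer b c d e a" "v \<in> outer c d e a b" "v \<in> outer d e a b c" "v \<in> outer e a b c d"
  using assms outer_rot by metis+

lemma outer_farI:
  assumes m: "max_c5 a b c d e" and v: "v \<in> outer a b c d e"
    and "p \<in> twins a b c d e" "q \<in> twins c d e a b"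
  shows "far p b q d e v"
proof -
  note m' = max_c5_rots[OF m]
  note t = twins_self[OF m'(6)] twins_self[OF m'(8)] twins_self[OF m'(9)]
  show ?thesis unfolding far_def
    using outer_far'[OF m v assms(3,4)] outer_far'[of b c d e a v b d] outer_far'[of c d e a b v q e]
      outer_far'[of d e a b c v d p] outer_far'[of e a b c d v e b] m' v assms(3,4) t outer_mem_rots[OF v]
    by blast
qed

text \<open>Both outer vertices are far for the 5-hole \<open>p b q d e\<close>, so
  \<open>far_edge\<close> applies to arbitrary members of the two classes.\<close>

lemma outer_edge:
  assumes m: "max_c5 a b c d e" and v: "v \<in> outer a b c d e" and w: "w \<in> outer a b c d e"
    and p: "p \<in> twins a b c d e" and q: "q \<in> twins c d e a b" and vw: "E v w"
  shows "\<not> (E v p \<and> E w q)"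
proof -
  note m' = max_c5_rots[OF m]
  have "\<not> E p q" using twins_anti[OF m'(5) p q] .
  then have "c5 p b q d e"
    using m'(5) p q sym unfolding c5_def twins_def by blast
  then show ?thesis using far_edge outer_farI[OF m v p q] outer_farI[OF m w p q] vw by blast
qed

text \<open>The path \<open>x y z\<close> closes up along one side of the hole: through
  \<open>c b a\<close> to a C6, or through \<open>c d e a\<close> to a C7. Additional edges to
  \<open>b\<close>, \<open>d\<close> or \<open>e\<close> shorten the cycle to another C6 or to a
  C4.\<close>

lemma outer_P3_core:
  assumes m: "max_c5 a b c d e"
    and o: "x \<in> outer a b c d e" "y \<in> outer a b c d e" "z \<in> outer a b c d e"
    and xyz: "E x y" "E y z" "\<not> E x z" "x \<noteq> z" and xa: "E x a" and zc: "E z c"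
  shows False
proof -
  note m' = max_c5_rots[OF m]
  note t = twins_self[OF m'(5)] twins_self[OF m'(6)] twins_self[OF m'(7)] twins_self[OF m'(8)] twins_self[OF m'(9)]
  have yx: "E y x" "E z y" using xyz sym by blast+
  have f: "far a b c d e x" "far a b c d e z"
    using outer_farI[OF m _ t(1,3)] o by blast+
  have nb: "x \<noteq> b" "z \<noteq> b" "y \<noteq> a" "y \<noteq> c"
    using o t unfolding outer_def ring_def by blast+
  \<comment> \<open>Each of these four vertices is at distance two on the hole from
    \<open>a\<close>, seen by \<open>x\<close>, or from \<open>c\<close>, seen by
    \<open>z\<close>.\<close>
  have "\<not> E y a" using outer_edge[OF m o(2,3) t(1,3)] xyz zc by blast
  moreover have "\<not> E y c" using outer_edge[OF m o(1,2) t(1,3)] xyz xa by blast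
  moreover have "\<not> E y d" using outer_edge[OF m'(3), of y x d a] outer_mem_rots[OF o(1)] outer_mem_rots[OF o(2)] outer_mem_rots[OF o(3)] yx t xa by blast
  moreover have "\<not> E y e" using outer_edge[OF m'(2), of z y c e] outer_mem_rots[OF o(1)] outer_mem_rots[OF o(2)] outer_mem_rots[OF o(3)] yx t zc by blast
  ultimately have y: "\<not> E y a" "\<not> E y c" "\<not> E y d" "\<not> E y e" by blast+
  have x: "\<not> E x c" "\<not> E x d" "\<not> E z a" "\<not> E z e" using f xa zc unfolding far_def by blast+
  show False
  proof (cases "E y b")
    case True
    have xb: "E x b" using no_C4[of x a b y] True nb y xyz xa m'(5) sym unfolding c5_def by metis
    have zb: "E z b" using no_C4[of z c b y] True nb y xyz zc m'(5) sym unfolding c5_def by metis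
    have "\<not> E x e" "\<not> E z d" using xb zb f unfolding far_def by blast+
    then show False using no_C7[of x y z c d e a] x y xyz xa zc m'(5) sym unfolding c5_def by metis
  next
    case yb: False
    consider "E x b" "E z b" | "E x b" "\<not> E z b" | "\<not> E x b" "E z b" | "\<not> E x b" "\<not> E z b" by blast
    then show False
    proof cases
      case 1
      have "y \<noteq> b" using o t unfolding outer_def ring_def by blast
      then show False using no_C4[of x y z b] 1 yb xyz sym by metis
    next
      case 2
      have xe: "\<not> E x e" using 2 f unfolding far_def by blast
      then show False
        using no_C6[of x y z d e a] no_C7[of x y z c d e a] x y xyz xa zc m'(5) sym
        unfolding c5_def by metis
    next
      case 3
      have zd: "\<not> E z d" using 3 f unfolding far_def by blast
      then show False
        using no_C6[of x y z c d e] no_C7[of x y z c d e a] x y xyz xa zc m'(5) sym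
        unfolding c5_def by metis
    next
      case 4
      then show False using no_C6[of x y z c b a] yb x y xyz xa zc m'(5) sym unfolding c5_def by metis
    qed
  qed
qed

text \<open>Two attachments at distance two come from one vertex of the path, from adjacent ones, or
  from its ends; these cases fall under \<open>outer_far'\<close>, \<open>outer_edge\<close> and
  \<open>outer_P3_core\<close>.\<close>

lemma outer_P3_core':
  assumes m: "max_c5 a b c d e"
    and o: "x \<in> outer a b c d e" "y \<in> outer a b c d e" "z \<in> outer a b c d e"
    and xyz: "E x y" "E y z" "\<not> E x z" "x \<noteq> z"
  shows "\<not> ((E x a \<or> E y a \<or> E z a) \<and> (E x c \<or> E y c \<or> E z c))"
proof -
  note m' = max_c5_rots[OF m]
  note t = twins_self[OF m'(5)] twins_self[OF m'(7)]
  have yx: "E y x" "E z y" "\<not> E z x" using xyz sym by blast+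
  show ?thesis
    using outer_far'[OF m _ t] outer_edge[OF m _ _ t] outer_P3_core[OF m o xyz]
      outer_P3_core[OF m o(3,2,1) yx(2,1,3)] o xyz yx by blast
qed

lemma outer_no_P3:
  assumes m: "max_c5 a b c d e"
    and o: "x \<in> outer a b c d e" "y \<in> outer a b c d e" "z \<in> outer a b c d e"
    and xy: "E x y" and yz: "E y z" and ne: "x \<noteq> z"
  shows "E x z"
proof (rule ccontr)
  assume n: "\<not> E x z"
  note m' = max_c5_rots[OF m]
  define h where "h u \<longleftrightarrow> E x u \<or> E y u \<or> E z u" for u
  have "\<not> (h a \<and> h c)" "\<not> (h b \<and> h d)" "\<not> (h c \<and> h e)" "\<not> (h d \<and> h a)" "\<not> (h e \<and> h b)"
    using outer_P3_core'[OF m o xy yz n ne]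
      outer_P3_core'[OF m'(1) outer_mem_rots(1)[OF o(1)] outer_mem_rots(1)[OF o(2)] outer_mem_rots(1)[OF o(3)] xy yz n ne]
      outer_P3_core'[OF m'(2) outer_mem_rots(2)[OF o(1)] outer_mem_rots(2)[OF o(2)] outer_mem_rots(2)[OF o(3)] xy yz n ne]
      outer_P3_core'[OF m'(3) outer_mem_rots(3)[OF o(1)] outer_mem_rots(3)[OF o(2)] outer_mem_rots(3)[OF o(3)] xy yz n ne]
      outer_P3_core'[OF m'(4) outer_mem_rots(4)[OF o(1)] outer_mem_rots(4)[OF o(2)] outer_mem_rots(4)[OF o(3)] xy yz n ne]
    unfolding h_def by blast+
  \<comment> \<open>The path touches no two nonadjacent vertices of the hole, hence at most two
    consecutive ones. The remaining three form a P3 anticomplete to \<open>x y z\<close>.\<close>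
  moreover have "h u \<or> h v \<or> h w" if "E u v" "E v w" "\<not> E u w" "u \<noteq> w" for u v w
    using no_2P3[of x y z u v w] that xy yz n ne unfolding h_def by metis
  moreover have "a \<noteq> c" "b \<noteq> d" "c \<noteq> e" "d \<noteq> a" "e \<noteq> b"
    using m'(5) sym unfolding c5_def by metis+
  ultimately show False using m'(5) sym unfolding c5_def by metis
qed

text \<open>After the exclusions below only the edges from \<open>v\<close> to \<open>e\<close> and
  from \<open>w\<close> to \<open>c\<close> are open, and not both occur. The first gives the C6
  \<open>v w q c d e\<close>, the second the C6 \<open>v w c d e p\<close>, neither the C7
  \<open>v w q c d e p\<close>.\<close>

lemma outer_nested_core:
  assumes m: "max_c5 a b c d e"
    and o: "v \<in> outer a b c d e" "w \<in> outer a b c d e" and vw: "E v w"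
    and p: "p \<in> twins a b c d e" and q: "q \<in> twins b c d e a"
    and vp: "E v p" "\<not> E w p" and wq: "E w q" "\<not> E v q" and n: "\<not> E p q"
  shows False
proof -
  note m' = max_c5_rots[OF m]
  note t = twins_self[OF m'(5)] twins_self[OF m'(6)] twins_self[OF m'(7)] twins_self[OF m'(8)] twins_self[OF m'(9)]
  have "\<not> E v c" using outer_far'[OF m o(1) p t(3)] vp by blast
  moreover have "\<not> E v d" using outer_far'[OF m'(3), of v d p] outer_mem_rots[OF o(1)] outer_mem_rots[OF o(2)] t p vp by blast
  moreover have "\<not> E w d" using outer_far'[OF m'(1), of w q d] outer_mem_rots[OF o(1)] outer_mem_rots[OF o(2)] t q wq by blast
  moreover have "\<not> E w e" using outer_far'[OF m'(4), of w e q] outer_mem_rots[OF o(1)] outer_mem_rots[OF o(2)] t q wq by blast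
  moreover have "\<not> (E v e \<and> E w c)" using outer_edge[OF m'(2), of w v c e] outer_mem_rots[OF o(1)] outer_mem_rots[OF o(2)] t vw sym by blast
  moreover have "\<not> E p c" "\<not> E p d" "E p e" "\<not> E q d" "\<not> E q e" "E q c"
    using p q unfolding twins_def by blast+
  ultimately show False
    using no_C6[of v w q c d e] no_C6[of v w c d e p] no_C7[of v w q c d e p] vp wq n vw m'(5) sym
    unfolding c5_def by metis
qed

lemma outer_nested_core':
  assumes m: "max_c5 a b c d e"
    and o: "v \<in> outer a b c d e" "w \<in> outer a b c d e" and vw: "E v w"
    and p: "p \<in> twins a b c d e" and q: "q \<in> ring a b c d e"
    and vp: "E v p" "\<not> E w p" and wq: "E w q" "\<not> E v q"
  shows "E p q"
proof (rule ccontr)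
  assume n: "\<not> E p q"
  note m' = max_c5_rots[OF m]
  have wv: "E w v" and n': "\<not> E q p" using vw n sym by blast+
  have pq: "p \<noteq> q" using vp wq by blast
  consider "q \<in> twins a b c d e" | "q \<in> twins b c d e a" | "q \<in> twins c d e a b"
    | "q \<in> twins d e a b c" | "q \<in> twins e a b c d" using q unfolding ring_def by blast
  then show False
  proof cases
    case 1 then show False using twins_clique[OF m'(5) p] pq n by blast
  next
    case 2 then show False using outer_nested_core[OF m o vw p _ vp wq n] by blast
  next
    case 3 then show False using outer_edge[OF m o p _ vw] vp wq by blast
  next
    case 4 then show False using outer_edge[OF m'(3), of w v q p] outer_mem_rots[OF o(1)] outer_mem_rots[OF o(2)] p wv vp wq by blast
  next
    case 5
    have "v \<in> outer e a b c d" "w \<in> outer e a b c d" using outer_mem_rots[OF o(1)] outer_mem_rots[OF o(2)] by blast+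
    then show False using outer_nested_core[OF m'(4) _ _ wv 5 p wq vp n'] by blast
  qed
qed

text \<open>Rotational symmetry: a ring vertex may be assumed to lie in the first class, as ring,
  outer vertices and centres do not change under rotation.\<close>

lemma ring_cases:
  assumes "max_c5 a b c d e" "p \<in> ring a b c d e"
  obtains a' b' c' d' e' where "max_c5 a' b' c' d' e'" "p \<in> twins a' b' c' d' e'"
    "ring a' b' c' d' e' = ring a b c d e" "outer a' b' c' d' e' = outer a b c d e"
    "centres a' b' c' d' e' = centres a b c d e"
proof -
  note m' = max_c5_rots[OF assms(1)]
  have rr: "ring b c d e a = ring a b c d e" "ring c d e a b = ring a b c d e"
    "ring d e a b c = ring a b c d e" "ring e a b c d = ring a b c d e"
    "centres b c d e a = centres a b c d e" "centres c d e a b = centres a b c d e"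
    "centres d e a b c = centres a b c d e" "centres e a b c d = centres a b c d e"
    using ring_rot centres_rot by metis+
  consider "p \<in> twins a b c d e" | "p \<in> twins b c d e a" | "p \<in> twins c d e a b"
    | "p \<in> twins d e a b c" | "p \<in> twins e a b c d" using assms(2) unfolding ring_def by blast
  then show thesis
  proof cases
    case 1 then show thesis using that[OF assms(1)] by simp
  next
    case 2 then show thesis using that[OF m'(1)] rr outer_rots(1)[of b c d e a] by simp
  next
    case 3 then show thesis using that[OF m'(2)] rr outer_rots(2)[of c d e a b] by simp
  next
    case 4 then show thesis using that[OF m'(3)] rr outer_rots(3)[of d e a b c] by simp
  next
    case 5 then show thesis using that[OF m'(4)] rr outer_rots(4)[of e a b c d] by simp
  qed
qed

lemma ring_centres:
  assumes "max_c5 a b c d e" "p \<in> ring a b c d e" "q \<in> centres a b c d e"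
  shows "E p q"
  using ring_cases[OF assms(1,2)] twins_centres assms(3) max_c5_rots(5) by metis

text \<open>Private neighbours \<open>p\<close> of \<open>v\<close> and \<open>q\<close> of
  \<open>w\<close> are adjacent in all cases, so \<open>v p q w\<close> would be a C4.\<close>

lemma outer_nested:
  assumes m: "max_c5 a b c d e"
    and o: "v \<in> outer a b c d e" "w \<in> outer a b c d e" and vw: "E v w"
    and p: "p \<in> ring a b c d e \<union> centres a b c d e" and q: "q \<in> ring a b c d e \<union> centres a b c d e"
    and vp: "E v p" "\<not> E w p" and wq: "E w q"
  shows "E v q"
proof (rule ccontr)
  assume vq: "\<not> E v q"
  note m' = max_c5_rots[OF m]
  have ne: "p \<noteq> q" "v \<noteq> q" "w \<noteq> p" using vp wq vq o p q unfolding outer_def by blast+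
  have "E p q"
  proof (cases "p \<in> ring a b c d e \<and> q \<in> ring a b c d e")
    case True
    then obtain a' b' c' d' e' where "max_c5 a' b' c' d' e'" "p \<in> twins a' b' c' d' e'"
      "ring a' b' c' d' e' = ring a b c d e" "outer a' b' c' d' e' = outer a b c d e"
      using ring_cases[OF m, of p] by metis
    then show ?thesis using outer_nested_core'[of a' b' c' d' e' v w p q] True o vw vp wq vq by metis
  next
    case False
    then show ?thesis
      using p q ring_centres[OF m] centres_clique[OF m'(5)] ne sym by blast
  qed
  then show False using no_C4[of v p q w] vp wq vq vw ne sym by metis
qed

lemma outer_attach_clique:
  assumes m: "max_c5 a b c d e" and o: "v \<in> outer a b c d e"
    and p: "p \<in> ring a b c d e \<union> centres a b c d e" and q: "q \<in> ring a b c d e \<union> centres a b c d e"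
    and vp: "E v p" and vq: "E v q" and ne: "p \<noteq> q"
  shows "E p q"
proof (cases "p \<in> ring a b c d e \<and> q \<in> ring a b c d e")
  case True
  then obtain a' b' c' d' e' where x: "max_c5 a' b' c' d' e'" "p \<in> twins a' b' c' d' e'"
    "ring a' b' c' d' e' = ring a b c d e" "outer a' b' c' d' e' = outer a b c d e"
    using ring_cases[OF m, of p] by metis
  note m' = max_c5_rots[OF x(1)]
  have o': "v \<in> outer a' b' c' d' e'" using o x by simp
  have oo: "v \<notin> ring a' b' c' d' e'" "v \<notin> centres a' b' c' d' e'" using o' unfolding outer_def by blast+
  have o4: "v \<notin> ring e' a' b' c' d'" "v \<notin> centres e' a' b' c' d'"
    using outer_mem_rots(4)[OF o'] unfolding outer_def by blast+
  have "q \<in> ring a' b' c' d' e'" using True x by blast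
  then consider "q \<in> twins a' b' c' d' e'" | "q \<in> twins b' c' d' e' a'" | "q \<in> twins c' d' e' a' b'"
    | "q \<in> twins d' e' a' b' c'" | "q \<in> twins e' a' b' c' d'" unfolding ring_def by blast
  then show ?thesis
  proof cases
    case 1 then show ?thesis using twins_clique[OF m'(5) x(2)] ne by blast
  next
    case 2 then show ?thesis using outer_clique[OF x(1) oo x(2) _ vp vq] by blast
  next
    case 3 then show ?thesis using outer_far'[OF x(1) o' x(2)] vp vq by blast
  next
    case 4 then show ?thesis
      using outer_far'[OF m'(3) outer_mem_rots(3)[OF o'] 4 x(2)] vp vq by blast
  next
    case 5 then show ?thesis
      using outer_clique[OF m'(4) o4 5 x(2) vq vp] sym by blast
  qed
next
  case False
  then show ?thesis
    using p q ring_centres[OF m] centres_clique[OF max_c5_rots(5)[OF m]] ne sym by blast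
qed

lemma outer_simplicial:
  assumes m: "max_c5 a b c d e" and o: "v0 \<in> outer a b c d e"
  shows "\<exists>v\<in>V. \<forall>x y. E v x \<longrightarrow> E v y \<longrightarrow> x \<noteq> y \<longrightarrow> E x y"
proof -
  \<comment> \<open>By \<open>outer_no_P3\<close> the component of \<open>v0\<close> among the outer
    vertices is a clique, so it consists of \<open>v0\<close> and its outer neighbours.\<close>
  define K where "K = {w \<in> outer a b c d e. w = v0 \<or> E w v0}"
  define A where "A v = {p \<in> ring a b c d e \<union> centres a b c d e. E v p}" for v
  have finA: "finite (A v)" for v
  proof (rule finite_subset[OF _ fin])
    show "A v \<subseteq> V" using in_V[OF sym] unfolding A_def by blast
  qed
  have "v0 \<in> K" using o unfolding K_def by blast
  then obtain v where v: "v \<in> K" and min: "\<And>w. w \<in> K \<Longrightarrow> card (A v) \<le> card (A w)"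
    using ex_has_least_nat[of "\<lambda>x. x \<in> K" v0 "\<lambda>x. card (A x)"] by blast
  have Kc: "E x y" if "x \<in> K" "y \<in> K" "x \<noteq> y" for x y
    using that outer_no_P3[OF m _ o, of x y] sym unfolding K_def by blast
  have Kn: "x \<in> K" if "x \<in> outer a b c d e" "E v x" for x
    using that v outer_no_P3[OF m that(1), of v v0] o sym unfolding K_def by blast
  have AK: "A v \<subseteq> A w" if w: "w \<in> K" for w
  proof (cases "w = v")
    case False
    then have vw: "E v w" using Kc v w by blast
    have "A v \<subseteq> A w \<or> A w \<subseteq> A v"
      using outer_nested[OF m _ _ vw] v w unfolding A_def K_def by blast
    \<comment> \<open>Inclusion the other way becomes equality, because \<open>A v\<close> has the
      least cardinality.\<close>
    then show ?thesis using card_seteq[OF finA _ min[OF w]] by blast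
  qed simp
  have split: "x \<in> K \<or> x \<in> A v" if "E v x" for x
  proof -
    have "x \<in> V" using in_V[OF sym[OF that]] .
    then show ?thesis using that Kn unfolding A_def outer_def by blast
  qed
  have "E x y" if "E v x" "E v y" "x \<noteq> y" for x y
    using split[OF that(1)] split[OF that(2)]
  proof (elim disjE)
    assume "x \<in> A v" "y \<in> A v"
    then show ?thesis using outer_attach_clique[OF m, of v x y] v that unfolding A_def K_def by blast
  next
    assume "x \<in> K" "y \<in> K"
    then show ?thesis using Kc that by blast
  next
    assume "x \<in> K" "y \<in> A v"
    then show ?thesis using AK unfolding A_def by blast
  next
    assume "x \<in> A v" "y \<in> K"
    then show ?thesis using AK sym unfolding A_def by blast
  qed
  moreover have "v \<in> V" using v unfolding K_def outer_def by blast
  ultimately show ?thesis by blast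
qed

section \<open>Existence of a 5-hole\<close>

text \<open>A neighbour \<open>s\<close> and a neighbour \<open>t\<close> of \<open>x\<close> that are nonadjacent form a \<open>P\<^sub>3\<close> with \<open>x\<close>,
  so the vertices of \<open>K\<close> adjacent to neither are a disjoint union of cliques; hence a shortest path
  in \<open>K\<close> from \<open>N(s)\<close> to \<open>N(t)\<close> has at most four vertices and closes up to a hole of length at most 7.\<close>

lemma attachment_clique:
  assumes nc5: "\<And>a b c d e. \<not> c5 a b c d e"
    and K: "\<And>k. k \<in> K \<Longrightarrow> k \<noteq> x \<and> \<not> E x k"
    and conn: "\<And>k l. k \<in> K \<Longrightarrow> l \<in> K \<Longrightarrow> (\<lambda>u v. u \<in> K \<and> v \<in> K \<and> E u v)\<^sup>*\<^sup>* k l"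
    and s: "E x s" "s0 \<in> K" "E s s0" and t: "E x t" "t0 \<in> K" "E t t0" and ne: "s \<noteq> t"
  shows "E s t"
proof (rule ccontr)
  assume n: "\<not> E s t"
  have dis: "\<not> (E s k \<and> E t k)" if "k \<in> K" for k
    using no_C4[of x s k t] K[OF that] s t n ne sym by metis
  \<comment> \<open>An edge would make \<open>x s k l t\<close> a 5-hole. \<open>ARB\<close> and
    \<open>ARRB\<close> exclude in the same way the C6 and C7 through one or two vertices of
    \<open>R\<close>.\<close>
  have AB: "\<not> E k l" if "k \<in> K" "l \<in> K" "E s k" "E t l" for k l
    using nc5[of x s k l t] K that dis s t n sym unfolding c5_def by metis
  define R where "R = {k \<in> K. \<not> E s k \<and> \<not> E t k}"
  have Rt: "E k m" if "k \<in> R" "l \<in> R" "m \<in> R" "E k l" "E l m" "k \<noteq> m" for k l m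
  proof (rule ccontr)
    assume "\<not> E k m"
    moreover have "\<not> E x k" "\<not> E x l" "\<not> E x m" using that K unfolding R_def by blast+
    moreover have "\<not> E s k" "\<not> E s l" "\<not> E s m" "\<not> E t k" "\<not> E t l" "\<not> E t m"
      using that unfolding R_def by blast+
    moreover have "E s x" using s(1) sym by blast
    ultimately show False using no_2P3[of s x t k l m] that s t n ne by blast
  qed
  have ARB: "\<not> E t m" if "k \<in> K" "E s k" "l \<in> R" "E k l" "m \<in> K" "E l m" for k l m
  proof
    assume "E t m"
    moreover have "\<not> E s m" "\<not> E t k" using that dis calculation by blast+
    moreover have "\<not> E k m" using AB[of k m] that calculation by blast
    moreover have "\<not> E x k" "\<not> E x l" "\<not> E x m" using that K unfolding R_def by blast+
    moreover have "\<not> E s l" "\<not> E t l" using that unfolding R_def by blast+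
    ultimately show False using no_C6[of x s k l m t] that s t n sym by metis
  qed
  have ARRB: "\<not> E t m" if "k \<in> K" "E s k" "l \<in> R" "E k l" "l' \<in> R" "E l l'" "m \<in> K" "E l' m" for k l l' m
  proof
    assume tm: "E t m"
    moreover have "\<not> E s m" "\<not> E t k" using that dis calculation by blast+
    moreover have "\<not> E k m" using AB[of k m] that calculation by blast
    moreover have "\<not> E x k" "\<not> E x l" "\<not> E x m" "\<not> E x l'" using that K unfolding R_def by blast+
    moreover have "\<not> E s l" "\<not> E t l" "\<not> E s l'" "\<not> E t l'" using that unfolding R_def by blast+
    moreover have "\<not> E k l'" "\<not> E l m" using ARB tm that by blast+
    ultimately show False using no_C7[of x s k l l' m t] that s t n sym by metis
  qed
  \<comment> \<open>What is reached in \<open>K\<close> from N(\<open>s\<close>) by at most two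
    steps into \<open>R\<close>. A third step gains nothing, as \<open>R\<close> has no induced P3,
    and no step leads to N(\<open>t\<close>). So \<open>D\<close> is closed under adjacency in
    \<open>K\<close> and contains \<open>t0\<close>, although none of its vertices sees
    \<open>t\<close>.\<close>
  define D where "D = {k \<in> K. E s k} \<union> {l \<in> R. \<exists>k\<in>K. E s k \<and> E k l} \<union>
    {l' \<in> R. \<exists>l\<in>R. E l l' \<and> (\<exists>k\<in>K. E s k \<and> E k l)}"
  have D_step: "v \<in> D" if u: "u \<in> D" and v: "v \<in> K" "E u v" for u v
  proof -
    consider "u \<in> K" "E s u" | k where "u \<in> R" "k \<in> K" "E s k" "E k u"
      | k l where "u \<in> R" "l \<in> R" "E l u" "k \<in> K" "E s k" "E k l" using u unfolding D_def by blast
    then have tv: "\<not> E t v"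
    proof cases
      case 1 then show ?thesis using AB[OF 1(1) v(1) 1(2)] v(2) by blast
    next
      case 2 then show ?thesis using ARB[OF 2(2,3,1,4) v] by blast
    next
      case 3 then show ?thesis using ARRB[OF 3(4,5,2,6,1,3) v] by blast
    qed
    show ?thesis
    proof (cases "E s v")
      case True then show ?thesis using v unfolding D_def by blast
    next
      case False
      then have vR: "v \<in> R" using tv v unfolding R_def by blast
      consider "u \<in> K" "E s u" | k where "u \<in> R" "k \<in> K" "E s k" "E k u"
        | k l where "u \<in> R" "l \<in> R" "E l u" "k \<in> K" "E s k" "E k l" using u unfolding D_def by blast
      then show ?thesis
      proof cases
        case 1 then show ?thesis using vR v unfolding D_def by blast
      next
        case 2 then show ?thesis using vR v unfolding D_def by blast
      next
        case 3
        have "l = v \<or> E l v" using Rt[of l u v] 3 vR v by blast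
        then show ?thesis using 3 vR unfolding D_def by blast
      qed
    qed
  qed
  have "t0 \<in> D" using conn[OF s(2) t(2)]
  proof (induction rule: rtranclp_induct)
    case base then show ?case using s unfolding D_def by blast
  next
    case (step y z) then show ?case using D_step[of y z] by blast
  qed
  then show False using dis[OF t(2)] t unfolding D_def R_def by blast
qed

text \<open>Dirac's theorem, strengthened for induction: the simplicial vertex of the subgraph on
  \<open>S\<close> is nonadjacent to a prescribed \<open>x\<close>. It is found in the component
  \<open>K\<close> of \<open>y\<close> among the nonneighbours of \<open>x\<close>; its neighbours
  in \<open>S\<close> lie in \<open>K\<close> or in the attachment \<open>T\<close> of
  \<open>K\<close> in N(\<open>x\<close>), a clique.\<close>

lemma chordal_simplicial:
  assumes nc5: "\<And>a b c d e. \<not> c5 a b c d e"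
    and "S \<subseteq> V" "x \<in> S" "y \<in> S" "x \<noteq> y" "\<not> E x y"
  shows "\<exists>v\<in>S. v \<noteq> x \<and> \<not> E x v \<and> (\<forall>p\<in>S. \<forall>q\<in>S. E v p \<longrightarrow> E v q \<longrightarrow> p \<noteq> q \<longrightarrow> E p q)"
  using assms(2-)
proof (induction "card S" arbitrary: S x y rule: less_induct)
  case less
  have finS: "finite S" using less.prems finite_subset[OF _ fin] by blast
  define M where "M = {k \<in> S. k \<noteq> x \<and> \<not> E x k}"
  define K where "K = {k. (\<lambda>u v. u \<in> M \<and> v \<in> M \<and> E u v)\<^sup>*\<^sup>* y k}"
  define T where "T = {s \<in> S. E x s \<and> (\<exists>k\<in>K. E s k)}"
  have yM: "y \<in> M" using less.prems unfolding M_def by blast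
  have yK: "y \<in> K" unfolding K_def by blast
  have KM: "k \<in> M" if "k \<in> K" for k
    using that unfolding K_def mem_Collect_eq
    by (induction rule: rtranclp_induct) (use yM in blast)+
  have KE: "l \<in> K" if "k \<in> K" "l \<in> M" "E k l" for k l
    using that KM[OF that(1)] unfolding K_def mem_Collect_eq by (simp add: rtranclp.rtrancl_into_rtrancl)
  have mono: "(\<lambda>u v. u \<in> K \<and> v \<in> K \<and> E u v)\<^sup>*\<^sup>* y k" if "k \<in> K" for k
  proof -
    have "(\<lambda>u v. u \<in> M \<and> v \<in> M \<and> E u v)\<^sup>*\<^sup>* y k" using that unfolding K_def by blast
    then show ?thesis
    proof (induction rule: rtranclp_induct)
      case (step u v)
      have "u \<in> K" using step unfolding K_def by blast
      then have "v \<in> K" using step KE by blast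
      then show ?case using step \<open>u \<in> K\<close> by (simp add: rtranclp.rtrancl_into_rtrancl)
    qed simp
  qed
  have symp: "symp (\<lambda>u v. u \<in> K \<and> v \<in> K \<and> E u v)\<^sup>*\<^sup>*"
    by (rule symp_rtranclp) (auto intro: sympI sym)
  have conn: "(\<lambda>u v. u \<in> K \<and> v \<in> K \<and> E u v)\<^sup>*\<^sup>* k l" if "k \<in> K" "l \<in> K" for k l
    by (rule rtranclp_trans[OF sympD[OF symp mono[OF that(1)]] mono[OF that(2)]])
  have Tc: "E s t" if st: "s \<in> T" "t \<in> T" "s \<noteq> t" for s t
  proof -
    obtain s0 t0 where "s0 \<in> K" "E s s0" "t0 \<in> K" "E t t0" using st unfolding T_def by blast
    then show ?thesis
      using attachment_clique[OF nc5 _ conn, of x s s0 t t0] KM st unfolding T_def M_def by blast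
  qed
  define H where "H = K \<union> T"
  have HS: "H \<subseteq> S" "x \<notin> H" using KM irrefl unfolding H_def T_def M_def by blast+
  have cH: "card H < card S"
    using psubset_card_mono[OF finS, of H] HS less.prems by blast
  have cK: "card K < card S"
    using psubset_card_mono[OF finS, of K] HS less.prems unfolding H_def by blast
  have nbr: "p \<in> H" if "k \<in> K" "p \<in> S" "E k p" for k p
  proof (cases "E x p")
    case True then show ?thesis using that sym unfolding H_def T_def by blast
  next
    case False
    have "p \<noteq> x" using KM[OF that(1)] that(3) sym unfolding M_def by blast
    then show ?thesis using KE[OF that(1) _ that(3)] that False unfolding H_def M_def by blast
  qed
  have "\<exists>v\<in>K. \<forall>p\<in>H. \<forall>q\<in>H. E v p \<longrightarrow> E v q \<longrightarrow> p \<noteq> q \<longrightarrow> E p q"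
  \<comment> \<open>If \<open>t\<close> in \<open>T\<close> misses a vertex of \<open>K\<close>,
    induction on \<open>H\<close> with \<open>t\<close> as prescribed vertex yields a vertex outside
    the clique \<open>T\<close>. Otherwise \<open>T\<close> is complete to \<open>K\<close>, and a
    simplicial vertex of \<open>K\<close> alone suffices.\<close>
  proof (cases "\<exists>t\<in>T. \<exists>k\<in>K. \<not> E t k")
    case True
    then obtain t k where tk: "t \<in> T" "k \<in> K" "\<not> E t k" by blast
    then have "t \<noteq> k" using KM unfolding T_def M_def by blast
    then obtain v where v: "v \<in> H" "v \<noteq> t" "\<not> E t v"
        "\<forall>p\<in>H. \<forall>q\<in>H. E v p \<longrightarrow> E v q \<longrightarrow> p \<noteq> q \<longrightarrow> E p q"
      using less.hyps[OF cH, of t k] tk HS less.prems(1) unfolding H_def by blast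
    then have "v \<in> K" using Tc tk unfolding H_def by blast
    then show ?thesis using v by blast
  next
    case False
    then have TK: "E t k" if "t \<in> T" "k \<in> K" for t k using that by blast
    have "\<exists>v\<in>K. \<forall>p\<in>K. \<forall>q\<in>K. E v p \<longrightarrow> E v q \<longrightarrow> p \<noteq> q \<longrightarrow> E p q"
    proof (cases "\<exists>k\<in>K. \<exists>l\<in>K. k \<noteq> l \<and> \<not> E k l")
      case True
      then obtain k l where "k \<in> K" "l \<in> K" "k \<noteq> l" "\<not> E k l" by blast
      moreover have "K \<subseteq> V" using HS less.prems(1) unfolding H_def by blast
      ultimately show ?thesis using less.hyps[OF cK, of k l] by blast
    next
      case False
      then show ?thesis using yK by blast
    qed
    then obtain v where v: "v \<in> K" "\<forall>p\<in>K. \<forall>q\<in>K. E v p \<longrightarrow> E v q \<longrightarrow> p \<noteq> q \<longrightarrow> E p q" by blast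
    have "E p q" if pq: "p \<in> H" "q \<in> H" "E v p" "E v q" "p \<noteq> q" for p q
    proof -
      consider "p \<in> K" "q \<in> K" | "p \<in> T" "q \<in> T" | "p \<in> T" "q \<in> K" | "q \<in> T" "p \<in> K"
        using pq(1,2) unfolding H_def by blast
      then show ?thesis
      proof cases
        case 1 then show ?thesis using v(2) pq by blast
      next
        case 2 then show ?thesis using Tc pq by blast
      next
        case 3 then show ?thesis using TK by blast
      next
        case 4 then show ?thesis using TK[OF 4] sym by blast
      qed
    qed
    then show ?thesis using v(1) by blast
  qed
  then obtain v where v: "v \<in> K" "\<forall>p\<in>H. \<forall>q\<in>H. E v p \<longrightarrow> E v q \<longrightarrow> p \<noteq> q \<longrightarrow> E p q" by blast
  then have "v \<in> S" "v \<noteq> x" "\<not> E x v" using KM unfolding M_def by blast+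
  then show ?case using v nbr by blast
qed

lemma ring_decomposition:
  assumes "V \<noteq> {}" and ns: "\<And>v. v \<in> V \<Longrightarrow> \<exists>x y. E v x \<and> E v y \<and> x \<noteq> y \<and> \<not> E x y"
  shows "\<exists>a b c d e. c5 a b c d e \<and> V = ring a b c d e \<union> centres a b c d e"
proof -
  have "\<exists>a b c d e. c5 a b c d e"
  proof (rule ccontr)
    assume "\<not> ?thesis"
    then have nc5: "\<And>a b c d e. \<not> c5 a b c d e" by blast
    obtain v where "v \<in> V" using assms(1) by blast
    then obtain x y where "E v x" "E v y" "x \<noteq> y" "\<not> E x y" using ns by blast
    then obtain w where "w \<in> V" "\<forall>p\<in>V. \<forall>q\<in>V. E w p \<longrightarrow> E w q \<longrightarrow> p \<noteq> q \<longrightarrow> E p q"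
      using chordal_simplicial[OF nc5 order_refl, of x y] in_V sym by metis
    then show False using ns in_V sym by metis
  qed
  then obtain a b c d e where m: "max_c5 a b c d e" using max_c5_exists by blast
  have "outer a b c d e = {}" using outer_simplicial[OF m] ns by blast
  moreover have "centres a b c d e \<subseteq> V" unfolding centres_def using in_V by blast
  ultimately have "V = ring a b c d e \<union> centres a b c d e"
    using ring_in_V[of a b c d e] unfolding outer_def by blast
  then show ?thesis using max_c5_rots(5)[OF m] by blast
qed

section \<open>The ring of a 5-hole as a 5-crown\<close>

lemma ring_nbrs:
  assumes "c5 a b c d e" "u \<in> twins a b c d e" "v \<in> ring a b c d e" "E u v"
  shows "v \<in> twins e a b c d \<union> twins a b c d e \<union> twins b c d e a"
proof -
  have "c5 d e a b c" using assms(1) c5_rot by blast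
  then show ?thesis
    using twins_anti[OF assms(1,2), of v] twins_anti[of d e a b c v u] assms sym
    unfolding ring_def by blast
qed

end

text \<open>Among finitely many pairwise comparable sets a maximal one is greatest; an element
  attaining it goes first.\<close>

lemma chain_ordering:
  fixes f :: "'b \<Rightarrow> 'c set"
  assumes "finite A" "\<And>u v. u \<in> A \<Longrightarrow> v \<in> A \<Longrightarrow> f u \<subseteq> f v \<or> f v \<subseteq> f u"
  shows "\<exists>us. distinct us \<and> set us = A \<and> sorted_wrt (\<lambda>u v. f v \<subseteq> f u) us"
  using assms
proof (induction "card A" arbitrary: A rule: less_induct)
  case less
  show ?case
  proof (cases "A = {}")
    case True
    then show ?thesis by (intro exI[of _ "[]"]) simp
  next
    case False
    obtain m where m: "m \<in> A" "\<And>u. u \<in> A \<Longrightarrow> f u \<subseteq> f m"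
    proof -
      have "finite (f ` A)" "f ` A \<noteq> {}" using less.prems(1) False by auto
      then obtain F where F: "F \<in> f ` A" "\<And>G. G \<in> f ` A \<Longrightarrow> F \<subseteq> G \<Longrightarrow> G = F"
        using finite_has_maximal[of "f ` A"] by metis
      then obtain m where "m \<in> A" "F = f m" by blast
      moreover have "f u \<subseteq> f m" if "u \<in> A" for u
        using less.prems(2)[OF that \<open>m \<in> A\<close>] F(2)[of "f u"] that \<open>F = f m\<close> by blast
      ultimately show thesis using that by blast
    qed
    have "card (A - {m}) < card A" using less.prems(1) m(1) by (simp add: card_gt_0_iff False)
    then obtain us where us: "distinct us" "set us = A - {m}" "sorted_wrt (\<lambda>u v. f v \<subseteq> f u) us"
      using less.hyps[of "A - {m}"] less.prems by blast
    then have "distinct (m # us) \<and> set (m # us) = A \<and> sorted_wrt (\<lambda>u v. f v \<subseteq> f u) (m # us)"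
      using m by auto
    then show ?thesis by blast
  qed
qed

lemma less_5_cases: "(x::nat) < 5 \<longleftrightarrow> x = 0 \<or> x = 1 \<or> x = 2 \<or> x = 3 \<or> x = 4"
  by auto

context free_graph begin

text \<open>Closed neighbourhoods within a class are comparable: \<open>twins_nested1\<close> and
  its mirror image exclude private neighbours on the same side, \<open>twins_nested2\<close> on
  opposite sides.\<close>

lemma twins_ordering:
  assumes c: "c5 a b c d e" and N: "\<And>v. N v = closed_nbrs (induced (V, E) (ring a b c d e)) v"
  shows "\<exists>us. distinct us \<and> set us = twins a b c d e \<and> twins a b c d e \<subseteq> N (last us) \<and>
    (\<forall>j. Suc j < length us \<longrightarrow> N (us ! Suc j) \<subseteq> N (us ! j)) \<and>
    N (hd us) = twins e a b c d \<union> twins a b c d e \<union> twins b c d e a"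
proof -
  have r: "c5 b c d e a" "c5 c d e a b" "c5 d e a b c" "c5 e a b c d"
    using c c5_rot by blast+
  let ?A = "twins a b c d e" and ?B = "twins b c d e a" and ?Z = "twins e a b c d"
  have AR: "?A \<union> ?B \<union> ?Z \<subseteq> ring a b c d e" unfolding ring_def by blast
  have N': "N v = insert v {u \<in> ring a b c d e. E v u}" if "v \<in> ?A" for v
    using that AR unfolding N closed_nbrs_def nbrs_def induced_def by auto
  have AN: "?A \<subseteq> N v" if "v \<in> ?A" for v
    using twins_clique[OF c that] AR unfolding N'[OF that] by blast
  have NA: "N v \<subseteq> ?Z \<union> ?A \<union> ?B" if "v \<in> ?A" for v
    using ring_nbrs[OF c that] that unfolding N'[OF that] by blast
  have Na: "N a = ?Z \<union> ?A \<union> ?B"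
  proof
    show "?Z \<union> ?A \<union> ?B \<subseteq> N a"
      using AR AN[OF twins_self[OF c]] sym unfolding N'[OF twins_self[OF c]] twins_def by blast
  qed (rule NA[OF twins_self[OF c]])
  have c': "c5 a e d c b" using c5_refl[OF c] .
  have nest: "N u \<subseteq> N v \<or> N v \<subseteq> N u" if u: "u \<in> ?A" and v: "v \<in> ?A" for u v
  proof (rule ccontr)
    assume "\<not> ?thesis"
    then obtain w w' where w: "w \<in> N u" "w \<notin> N v" "w' \<in> N v" "w' \<notin> N u" by blast
    have wB: "w \<in> ?Z \<union> ?B" "w' \<in> ?Z \<union> ?B" using NA u v AN w by blast+
    then have "w \<noteq> u" "w' \<noteq> v" "w \<in> ring a b c d e" "w' \<in> ring a b c d e" using w u v AN AR by blast+
    then have e: "E u w" "\<not> E v w" "E v w'" "\<not> E u w'" using w N' u v by blast+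
    have uv': "u \<in> twins a e d c b" "v \<in> twins a e d c b"
      using u v twins_refl by blast+
    consider "w \<in> ?B" "w' \<in> ?B" | "w \<in> ?Z" "w' \<in> ?Z" | "w \<in> ?B" "w' \<in> ?Z" | "w \<in> ?Z" "w' \<in> ?B"
      using wB by blast
    then show False
    proof cases
      case 1 then show ?thesis using twins_nested1[OF c u v 1 e(1-3)] e by blast
    next
      case 2
      then have "w \<in> twins e d c b a" "w' \<in> twins e d c b a" using twins_refl by blast+
      then show ?thesis using twins_nested1[OF c' uv' _ _ e(1-3)] e by blast
    next
      case 3 then show ?thesis using twins_nested2[OF c u v 3 e(1-3)] e by blast
    next
      case 4 then show ?thesis using twins_nested2[OF c v u 4(2,1) e(3,4,1)] e by blast
    qed
  qed
  have "?A \<subseteq> V" using AR ring_in_V[of a b c d e] by blast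
  then have "finite ?A" by (rule finite_subset[OF _ fin])
  then obtain us where us: "distinct us" "set us = ?A" "sorted_wrt (\<lambda>u v. N v \<subseteq> N u) us"
    using chain_ordering[of ?A N] nest by blast
  have a: "a \<in> set us" using us twins_self[OF c] by blast
  then have ne: "us \<noteq> []" by auto
  \<comment> \<open>The head need not be \<open>a\<close>, but its neighbourhood contains that of
    \<open>a\<close>, which is already the largest possible.\<close>
  have "N a \<subseteq> N (hd us)"
    using us(3) a ne by (cases us) auto
  then have "N (hd us) = ?Z \<union> ?A \<union> ?B" using NA[of "hd us"] Na us(2) hd_in_set[OF ne] by blast
  moreover have "?A \<subseteq> N (last us)" using AN us(2) last_in_set[OF ne] by blast
  moreover have "\<forall>j. Suc j < length us \<longrightarrow> N (us ! Suc j) \<subseteq> N (us ! j)"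
    using us(3) by (simp add: sorted_wrt_iff_nth_less)
  ultimately show ?thesis using us(1,2) by blast
qed

lemma twins_disjoint:
  assumes "c5 a b c d e"
  shows "twins a b c d e \<inter> twins b c d e a = {}" "twins a b c d e \<inter> twins c d e a b = {}"
  using assms sym unfolding c5_def twins_def by blast+

lemma five_crown_ring:
  assumes c: "c5 a b c d e"
  shows "five_crown (induced (V, E) (ring a b c d e))"
proof -
  have r: "c5 b c d e a" "c5 c d e a b" "c5 d e a b c" "c5 e a b c d"
    using c c5_rot by blast+
  let ?R = "induced (V, E) (ring a b c d e)"
  define X where "X = nth [twins a b c d e, twins b c d e a, twins c d e a b, twins d e a b c, twins e a b c d]"
  have X: "X 0 = twins a b c d e" "X 1 = twins b c d e a" "X 2 = twins c d e a b"
    "X 3 = twins d e a b c" "X 4 = twins e a b c d"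
    unfolding X_def by (simp_all add: numeral_eq_Suc)
  have U: "(\<Union>i<5. X i) = fst ?R"
  proof -
    have "{..<5::nat} = {0,1,2,3,4}" by auto
    then show ?thesis using X unfolding induced_def ring_def by auto
  qed
  have disj: "X i \<inter> X j = {}" if "i < 5" "j < 5" "i \<noteq> j" for i j
    using that twins_disjoint[OF c] twins_disjoint[OF r(1)] twins_disjoint[OF r(2)]
      twins_disjoint[OF r(3)] twins_disjoint[OF r(4)] X unfolding less_5_cases
    by (elim disjE) (simp_all add: Int_commute)
  have ne: "X i \<noteq> {}" if "i < 5" for i
    using that twins_self[OF c] twins_self[OF r(1)] twins_self[OF r(2)] twins_self[OF r(3)]
      twins_self[OF r(4)] X unfolding less_5_cases by auto
  have rr: "ring b c d e a = ring a b c d e" "ring c d e a b = ring a b c d e"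
    "ring d e a b c = ring a b c d e" "ring e a b c d = ring a b c d e"
    using ring_rot by metis+
  have ord: "\<exists>us. distinct us \<and> set us = X i \<and> X i \<subseteq> closed_nbrs ?R (last us) \<and>
      (\<forall>j. Suc j < length us \<longrightarrow> closed_nbrs ?R (us ! Suc j) \<subseteq> closed_nbrs ?R (us ! j)) \<and>
      closed_nbrs ?R (hd us) = X ((i + 4) mod 5) \<union> X i \<union> X ((i + 1) mod 5)" if "i < 5" for i
    using that X X(3)[unfolded numeral_2_eq_2] twins_ordering[OF c, of "closed_nbrs ?R"] twins_ordering[OF r(1), of "closed_nbrs ?R"]
      twins_ordering[OF r(2), of "closed_nbrs ?R"] twins_ordering[OF r(3), of "closed_nbrs ?R"]
      twins_ordering[OF r(4), of "closed_nbrs ?R"] rr unfolding less_5_cases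
    by (elim disjE) simp_all
  have rp: "ring_partition ?R X"
    unfolding ring_partition_def using U disj ne ord by blast
  define I where "I i j \<longleftrightarrow> \<not> complete_to ?R (X i) (X j)" for i j
  have I: "\<exists>u\<in>X i. \<exists>v\<in>X j. \<not> E u v" if "I i j" "i < 5" "j < 5" for i j
    using that U unfolding I_def complete_to_def induced_def by auto
  have tri: "\<not> (I i j \<and> I j k \<and> I k l)"
    if h: "c5 p q r s t" "X i = twins p q r s t" "X j = twins q r s t p" "X k = twins r s t p q"
      "X l = twins s t p q r" "i < 5" "j < 5" "k < 5" "l < 5" for i j k l p q r s t
  proof
    assume "I i j \<and> I j k \<and> I k l"
    then obtain p0 p1 q1 q2 r2 r3 where "p0 \<in> X i" "p1 \<in> X j" "\<not> E p0 p1"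
      "q1 \<in> X j" "q2 \<in> X k" "\<not> E q1 q2" "r2 \<in> X k" "r3 \<in> X l" "\<not> E r2 r3"
      using I h(6-9) by meson
    then show False using twins_three_incomplete[OF h(1)] unfolding h(2-5) by blast
  qed
  have I3: "\<not> (I 0 1 \<and> I 1 2 \<and> I 2 3)" "\<not> (I 1 2 \<and> I 2 3 \<and> I 3 4)" "\<not> (I 2 3 \<and> I 3 4 \<and> I 4 0)"
     "\<not> (I 3 4 \<and> I 4 0 \<and> I 0 1)" "\<not> (I 4 0 \<and> I 0 1 \<and> I 1 2)"
    using tri[OF c X(1,2,3,4)] tri[OF r(1) X(2,3,4,5)] tri[OF r(2) X(3,4,5,1)]
      tri[OF r(3) X(4,5,1,2)] tri[OF r(4) X(5,1,2,3)] by simp_all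
  have Is: "I i j \<longleftrightarrow> I j i" for i j
    using sym unfolding I_def complete_to_def induced_def by auto
  \<comment> \<open>\<open>I\<close> marks incomplete pairs of classes. A crown needs two complete
    pairs at distance two in the cyclic order of the five consecutive pairs. Without such, at most
    two pairs are complete, and the other three include a forbidden run as in
    \<open>I3\<close>.\<close>
  have "\<exists>i<5. \<not> I ((i + 4) mod 5) ((i + 3) mod 5) \<and> \<not> I ((i + 1) mod 5) ((i + 2) mod 5)"
  proof -
    consider "\<not> I 4 3 \<and> \<not> I 1 2" | "\<not> I 0 4 \<and> \<not> I 2 3" | "\<not> I 1 0 \<and> \<not> I 3 4" | "\<not> I 2 1 \<and> \<not> I 4 0"
      | "\<not> I 3 2 \<and> \<not> I 0 1" using I3 Is by metis
    then show ?thesis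
    proof cases
      case 1 then show ?thesis by (intro exI[of _ 0]) (simp add: numeral_2_eq_2)
    next
      case 2 then show ?thesis by (intro exI[of _ 1]) (simp add: numeral_2_eq_2)
    next
      case 3 then show ?thesis by (intro exI[of _ 2]) (simp add: numeral_2_eq_2)
    next
      case 4 then show ?thesis by (intro exI[of _ 3]) (simp add: numeral_2_eq_2)
    next
      case 5 then show ?thesis by (intro exI[of _ 4]) (simp add: numeral_2_eq_2)
    qed
  qed
  then show ?thesis using rp unfolding I_def five_crown_def by blast
qed

end

section \<open>From forbidden induced subgraphs to the locale\<close>

lemma contains_induced_nth:
  assumes "distinct vs" "length vs = n" "set vs \<subseteq> fst G" "fst H = {0..<n}"
    and "\<And>i j. i < n \<Longrightarrow> j < n \<Longrightarrow> snd G (vs ! i) (vs ! j) \<longleftrightarrow> snd H i j"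
  shows "contains_induced G H"
  unfolding contains_induced_def
proof (intro exI[of _ "nth vs"] conjI)
  show "inj_on (nth vs) (fst H)" using assms(1,2,4) by (simp add: inj_on_def nth_eq_iff_index_eq)
  show "nth vs ` fst H \<subseteq> fst G" using assms(2,3,4) by (auto simp: subset_iff)
  show "\<forall>x\<in>fst H. \<forall>y\<in>fst H. snd G (vs ! x) (vs ! y) \<longleftrightarrow> snd H x y" using assms(4,5) by simp
qed

lemma less_simps: "(i::nat) < 4 \<longleftrightarrow> i = 0 \<or> i = 1 \<or> i = 2 \<or> i = 3"
  "i < 6 \<longleftrightarrow> i = 0 \<or> i = 1 \<or> i = 2 \<or> i = 3 \<or> i = 4 \<or> i = 5"
  "i < 7 \<longleftrightarrow> i = 0 \<or> i = 1 \<or> i = 2 \<or> i = 3 \<or> i = 4 \<or> i = 5 \<or> i = 6"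
  by auto

lemma free_graph_intro:
  assumes g: "is_graph G" and f: "free_of G two_P3" "free_of G (cycle_graph 4)" "free_of G (cycle_graph 6)"
    "free_of G (cycle_graph 7)" "free_of G three_pentagon"
  shows "free_graph (fst G) (snd G)"
proof -
  let ?E = "snd G"
  have ir: "\<not> ?E x x" and V: "?E x y \<Longrightarrow> x \<in> fst G" for x y
    using g unfolding is_graph_def by blast+
  have s: "?E x y \<Longrightarrow> ?E y x" and ns: "\<not> ?E x y \<Longrightarrow> \<not> ?E y x" for x y
    using g unfolding is_graph_def by blast+
  have ind: False if "distinct vs" "length vs = n" "fst H = {0..<n}" "free_of G H" "set vs \<subseteq> fst G"
    "\<forall>i<n. \<forall>j<n. snd G (vs ! i) (vs ! j) \<longleftrightarrow> snd H i j" for vs n and H :: "nat graph"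
    using that contains_induced_nth[of vs n G H] unfolding free_of_def by blast
  show ?thesis
  proof
    show "finite (fst G)" using g unfolding is_graph_def by blast
  next
    fix x y assume "?E x y" then show "x \<in> fst G" by (rule V)
  next
    fix x show "\<not> ?E x x" by (rule ir)
  next
    fix x y assume "?E x y" then show "?E y x" by (rule s)
  next
    fix a b c d
    assume e: "?E a b" "?E b c" "?E c d" "?E d a" and n: "\<not> ?E a c" "\<not> ?E b d" and ne: "a \<noteq> c" "b \<noteq> d"
    note facts = e n ne e[THEN s] n[THEN ns] ir
    show False
      by (rule ind[OF _ _ _ f(2), of "[a, b, c, d]" 4])
        (use facts V in \<open>auto simp: less_simps cycle_graph_def\<close>)
  next
    fix a b c d x y
    assume e: "?E a b" "?E b c" "?E c d" "?E d x" "?E x y" "?E y a"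
      and n: "\<not> ?E a c" "\<not> ?E a d" "\<not> ?E a x" "\<not> ?E b d" "\<not> ?E b x" "\<not> ?E b y" "\<not> ?E c x" "\<not> ?E c y" "\<not> ?E d y"
    note facts = e n e[THEN s] n[THEN ns] ir
    show False
      by (rule ind[OF _ _ _ f(3), of "[a, b, c, d, x, y]" 6])
        (use facts V in \<open>auto simp: less_simps cycle_graph_def\<close>)
  next
    fix a b c d x y z
    assume e: "?E a b" "?E b c" "?E c d" "?E d x" "?E x y" "?E y z" "?E z a"
      and n: "\<not> ?E a c" "\<not> ?E a d" "\<not> ?E a x" "\<not> ?E a y" "\<not> ?E b d" "\<not> ?E b x" "\<not> ?E b y" "\<not> ?E b z"
        "\<not> ?E c x" "\<not> ?E c y" "\<not> ?E c z" "\<not> ?E d y" "\<not> ?E d z" "\<not> ?E x z"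
    note facts = e n e[THEN s] n[THEN ns] ir
    show False
      by (rule ind[OF _ _ _ f(4), of "[a, b, c, d, x, y, z]" 7])
        (use facts V in \<open>auto simp: less_simps cycle_graph_def\<close>)
  next
    fix a b c d x y
    assume e: "?E a b" "?E b c" and ne: "a \<noteq> c" and n: "\<not> ?E a c" and e': "?E d x" "?E x y" and ne': "d \<noteq> y"
      and n': "\<not> ?E d y" "\<not> ?E a d" "\<not> ?E a x" "\<not> ?E a y" "\<not> ?E b d" "\<not> ?E b x" "\<not> ?E b y"
        "\<not> ?E c d" "\<not> ?E c x" "\<not> ?E c y"
    note facts = e n ne e' n' ne' e[THEN s] n[THEN ns] e'[THEN s] n'[THEN ns] ir
    show False
      by (rule ind[OF _ _ _ f(1), of "[a, b, c, d, x, y]" 6])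
        (use facts V in \<open>auto simp: less_simps two_P3_def edges_graph_def\<close>)
  next
    fix a b1 b2 b3 c1 c2 c3
    assume e: "?E a b1" "?E a b2" "?E a b3" "?E b1 c1" "?E b2 c2" "?E b3 c3" "?E c1 c2" "?E c1 c3" "?E c2 c3"
      and n: "\<not> ?E a c1" "\<not> ?E a c2" "\<not> ?E a c3" "\<not> ?E b1 b2" "\<not> ?E b1 b3" "\<not> ?E b2 b3"
        "\<not> ?E b1 c2" "\<not> ?E b1 c3" "\<not> ?E b2 c1" "\<not> ?E b2 c3" "\<not> ?E b3 c1" "\<not> ?E b3 c2"
    note facts = e n e[THEN s] n[THEN ns] ir
    show False
      by (rule ind[OF _ _ _ f(5), of "[a, b1, b2, b3, c1, c2, c3]" 7])
        (use facts V in \<open>auto simp: less_simps three_pentagon_def edges_graph_def\<close>)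
  qed
qed

text \<open>The ring is the crown, and the centres are the universal vertices added to it.\<close>

lemma crown_plus_universal_if_free:
  assumes g: "is_graph G" and f: "free_of G two_P3" "free_of G (cycle_graph 4)" "free_of G (cycle_graph 6)"
    "free_of G (cycle_graph 7)" "free_of G three_pentagon" and ns: "\<forall>v\<in>fst G. \<not> simplicial G v"
  shows "crown_plus_universal G"
proof -
  interpret free_graph "fst G" "snd G" using free_graph_intro[OF g f] .
  have "\<exists>x y. snd G v x \<and> snd G v y \<and> x \<noteq> y \<and> \<not> snd G x y" if "v \<in> fst G" for v
    using ns that unfolding simplicial_def is_clique_def nbrs_def by blast
  moreover have "fst G \<noteq> {}" using g unfolding is_graph_def by blast
  ultimately obtain a b c d e where c: "c5 a b c d e" and V: "fst G = ring a b c d e \<union> centres a b c d e"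
    using ring_decomposition by blast
  have r: "c5 b c d e a" "c5 c d e a b" "c5 d e a b c" "c5 e a b c d"
    using c c5_rot by blast+
  have cc: "centres b c d e a = centres a b c d e" "centres c d e a b = centres a b c d e"
    "centres d e a b c = centres a b c d e" "centres e a b c d = centres a b c d e"
    using centres_rot by metis+
  have "snd G v u" if "u \<in> ring a b c d e" "v \<in> centres a b c d e" for u v
  proof -
    have "snd G u v"
      using that twins_centres[OF c] twins_centres[OF r(1)] twins_centres[OF r(2)]
        twins_centres[OF r(3)] twins_centres[OF r(4)] unfolding ring_def cc by blast
    then show ?thesis by (rule sym)
  qed
  then have "complete_to G (centres a b c d e) (ring a b c d e)"
    unfolding complete_to_def by blast
  moreover have "is_clique G (centres a b c d e)"
    using centres_clique[OF c] V unfolding is_clique_def by blast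
  moreover have "fst G - ring a b c d e \<subseteq> centres a b c d e" using V by blast
  moreover have "five_crown (induced G (ring a b c d e))" using five_crown_ring[OF c] by simp
  ultimately show ?thesis
    unfolding crown_plus_universal_def is_clique_def complete_to_def
    by (intro exI[of _ "ring a b c d e"] conjI) (use V in \<open>simp, blast+\<close>)
qed

section \<open>Crowns are free\<close>

text \<open>What the later arguments use of a ring partition, with the orderings forgotten and the
  class index as a function. The vertex \<open>t\<close> of the last clause is the head of an
  ordering.\<close>

definition ring_class :: "'a graph \<Rightarrow> (nat \<Rightarrow> 'a set) \<Rightarrow> ('a \<Rightarrow> nat) \<Rightarrow> bool" where
  "ring_class R X cl \<longleftrightarrow>
    (\<forall>v\<in>fst R. cl v < 5 \<and> v \<in> X (cl v)) \<and>
    (\<forall>u\<in>fst R. \<forall>v\<in>fst R. cl u = cl v \<longrightarrow> u \<noteq> v \<longrightarrow> snd R u v) \<and>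
    (\<forall>u\<in>fst R. \<forall>v\<in>fst R. cl u = cl v \<longrightarrow>
      closed_nbrs R u \<subseteq> closed_nbrs R v \<or> closed_nbrs R v \<subseteq> closed_nbrs R u) \<and>
    (\<forall>u v. snd R u v \<longrightarrow> cl v = cl u \<or> cl v = (cl u + 1) mod 5 \<or> cl v = (cl u + 4) mod 5) \<and>
    (\<forall>i<5. \<exists>t\<in>fst R. cl t = i \<and>
      (\<forall>v\<in>fst R. cl v = (i + 1) mod 5 \<or> cl v = (i + 4) mod 5 \<longrightarrow> snd R t v))"

lemma ring_classD:
  assumes "ring_class R X cl"
  shows "v \<in> fst R \<Longrightarrow> cl v < 5 \<and> v \<in> X (cl v)"
    and "u \<in> fst R \<Longrightarrow> v \<in> fst R \<Longrightarrow> cl u = cl v \<Longrightarrow> u \<noteq> v \<Longrightarrow> snd R u v"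
    and "u \<in> fst R \<Longrightarrow> v \<in> fst R \<Longrightarrow> cl u = cl v \<Longrightarrow>
      closed_nbrs R u \<subseteq> closed_nbrs R v \<or> closed_nbrs R v \<subseteq> closed_nbrs R u"
    and "snd R u v \<Longrightarrow> cl v = cl u \<or> cl v = (cl u + 1) mod 5 \<or> cl v = (cl u + 4) mod 5"
    and "i < 5 \<Longrightarrow> \<exists>t\<in>fst R. cl t = i \<and>
      (\<forall>v\<in>fst R. cl v = (i + 1) mod 5 \<or> cl v = (i + 4) mod 5 \<longrightarrow> snd R t v)"
  using assms unfolding ring_class_def by simp_all

lemma mod5_neq:
  assumes "(i::nat) < 5"
  shows "i \<noteq> (i + 1) mod 5" "i \<noteq> (i + 4) mod 5"
  using assms unfolding less_5_cases by auto

lemma mod5_cases: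
  assumes "(i::nat) < 5" "k < 5"
  shows "k = i \<or> k = (i + 1) mod 5 \<or> k = (i + 2) mod 5 \<or> k = (i + 3) mod 5 \<or> k = (i + 4) mod 5"
  using assms unfolding less_5_cases by auto

lemma ring_class_exists:
  assumes g: "is_graph R" and rp: "ring_partition R X"
  shows "\<exists>cl. ring_class R X cl"
proof -
  have U: "(\<Union>i<5. X i) = fst R" and disj: "\<And>i j. i < 5 \<Longrightarrow> j < 5 \<Longrightarrow> i \<noteq> j \<Longrightarrow> X i \<inter> X j = {}"
    and ne: "\<And>i. i < 5 \<Longrightarrow> X i \<noteq> {}"
    using rp[unfolded ring_partition_def, THEN conjunct1]
      rp[unfolded ring_partition_def, THEN conjunct2, THEN conjunct1]
      rp[unfolded ring_partition_def, THEN conjunct2, THEN conjunct2, THEN conjunct1] by blast+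
  have "\<forall>v\<in>fst R. \<exists>i. i < 5 \<and> v \<in> X i" using U by blast
  then obtain cl where cl: "\<And>v. v \<in> fst R \<Longrightarrow> cl v < 5 \<and> v \<in> X (cl v)" by metis
  have cl': "v \<in> fst R \<and> cl v = i" if "i < 5" "v \<in> X i" for i v
    using that U cl[of v] disj[of i "cl v"] by blast
  have chain: "(\<forall>u\<in>X i. X i \<subseteq> closed_nbrs R u \<and> closed_nbrs R u \<subseteq> X ((i + 4) mod 5) \<union> X i \<union> X ((i + 1) mod 5))
      \<and> (\<forall>u\<in>X i. \<forall>v\<in>X i. closed_nbrs R u \<subseteq> closed_nbrs R v \<or> closed_nbrs R v \<subseteq> closed_nbrs R u)
      \<and> (\<exists>t\<in>X i. closed_nbrs R t = X ((i + 4) mod 5) \<union> X i \<union> X ((i + 1) mod 5))" if i: "i < 5" for i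
  proof -
    obtain us where us: "set us = X i" "X i \<subseteq> closed_nbrs R (last us)"
        "\<And>j. Suc j < length us \<Longrightarrow> closed_nbrs R (us ! Suc j) \<subseteq> closed_nbrs R (us ! j)"
        "closed_nbrs R (hd us) = X ((i + 4) mod 5) \<union> X i \<union> X ((i + 1) mod 5)"
      using rp[unfolded ring_partition_def, THEN conjunct2, THEN conjunct2, THEN conjunct2] i by blast
    have ne': "us \<noteq> []" using us(1) ne[OF i] by auto
    have mono: "closed_nbrs R (us ! k) \<subseteq> closed_nbrs R (us ! j)" if "j \<le> k" "k < length us" for j k
      using that
    proof (induction rule: dec_induct)
      case (step n)
      then show ?case using us(3)[of n] by auto
    qed simp
    \<comment> \<open>Every closed neighbourhood lies between those of the last and the first vertex
      of the ordering.\<close>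
    have l: "X i \<subseteq> closed_nbrs R u \<and> closed_nbrs R u \<subseteq> closed_nbrs R (hd us)" if u: "u \<in> X i" for u
    proof -
      obtain k where "k < length us" "u = us ! k" using u us(1) by (metis in_set_conv_nth)
      then show ?thesis
        using mono[of k "length us - 1"] mono[of 0 k] us(2) ne'
        by (simp add: last_conv_nth hd_conv_nth) (metis Suc_pred length_greater_0_conv less_Suc_eq_le order_trans)
    qed
    have c: "closed_nbrs R u \<subseteq> closed_nbrs R v \<or> closed_nbrs R v \<subseteq> closed_nbrs R u"
      if uv: "u \<in> X i" "v \<in> X i" for u v
    proof -
      obtain k j where "k < length us" "u = us ! k" "j < length us" "v = us ! j"
        using uv us(1) by (metis in_set_conv_nth)
      then show ?thesis using mono[of k j] mono[of j k] nat_le_linear[of k j] by blast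
    qed
    have "hd us \<in> X i" using hd_in_set[OF ne'] us(1) by simp
    then show ?thesis using l c us(4) by blast
  qed
  have inV: "snd R x y \<Longrightarrow> x \<in> fst R \<and> y \<in> fst R" for x y
    using g unfolding is_graph_def by blast+
  have "ring_class R X cl"
    unfolding ring_class_def
  proof (intro conjI ballI allI impI)
    fix v assume v: "v \<in> fst R"
    show "cl v < 5" "v \<in> X (cl v)" using cl[OF v] by blast+
  next
    fix u v assume uv: "u \<in> fst R" "v \<in> fst R" "cl u = cl v"
    then have X: "u \<in> X (cl u)" "v \<in> X (cl u)" "cl u < 5" using cl[OF uv(1)] cl[OF uv(2)] by simp_all
    show "closed_nbrs R u \<subseteq> closed_nbrs R v \<or> closed_nbrs R v \<subseteq> closed_nbrs R u"
      using chain X by blast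
    show "snd R u v" if "u \<noteq> v"
    proof -
      have "v \<in> closed_nbrs R u" using chain X by blast
      then show ?thesis using that unfolding closed_nbrs_def nbrs_def by blast
    qed
  next
    fix u v assume uv: "snd R u v"
    show "cl v = cl u \<or> cl v = (cl u + 1) mod 5 \<or> cl v = (cl u + 4) mod 5"
    proof -
      have "v \<in> closed_nbrs R u" using uv inV unfolding closed_nbrs_def nbrs_def by blast
      then have "v \<in> X ((cl u + 4) mod 5) \<union> X (cl u) \<union> X ((cl u + 1) mod 5)"
        using chain[of "cl u"] cl[of u] inV[OF uv] by blast
      then show ?thesis using cl'[of "(cl u + 4) mod 5" v] cl'[of "cl u" v] cl'[of "(cl u + 1) mod 5" v]
        cl[of u] inV[OF uv] by auto
    qed
  next
    fix i :: nat assume i: "i < 5"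
    show "\<exists>t\<in>fst R. cl t = i \<and>
      (\<forall>v\<in>fst R. cl v = (i + 1) mod 5 \<or> cl v = (i + 4) mod 5 \<longrightarrow> snd R t v)"
    proof -
      obtain t where t: "t \<in> X i" "closed_nbrs R t = X ((i + 4) mod 5) \<union> X i \<union> X ((i + 1) mod 5)"
        using chain[OF i] by blast
      have "snd R t v" if v: "v \<in> fst R" "cl v = (i + 1) mod 5 \<or> cl v = (i + 4) mod 5" for v
      proof -
        have "cl v \<noteq> i" using v(2) mod5_neq[OF i] by argo
        then have "v \<noteq> t" using cl'[OF i t(1)] by blast
        moreover have "v \<in> X ((i + 1) mod 5) \<or> v \<in> X ((i + 4) mod 5)"
          using v(2) cl[OF v(1)] by metis
        then have "v \<in> closed_nbrs R t" unfolding t(2) by blast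
        ultimately show ?thesis unfolding closed_nbrs_def nbrs_def by blast
      qed
      then show ?thesis using cl'[OF i t(1)] by blast
    qed
  qed
  then show ?thesis by blast
qed

text \<open>Two vertices of a copy of \<open>H\<close> in one class would be adjacent with
  comparable closed neighbourhoods, while the condition on \<open>H\<close> says that adjacent
  vertices never have comparable ones.\<close>

lemma ring_free_of_class_inj:
  assumes "is_graph R"
    and cl: "\<And>u v. u \<in> fst R \<Longrightarrow> v \<in> fst R \<Longrightarrow> cl u = cl v \<Longrightarrow> u \<noteq> v \<Longrightarrow> snd R u v"
      "\<And>u v. u \<in> fst R \<Longrightarrow> v \<in> fst R \<Longrightarrow> cl u = cl v \<Longrightarrow>
      closed_nbrs R u \<subseteq> closed_nbrs R v \<or> closed_nbrs R v \<subseteq> closed_nbrs R u"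
    and f: "inj_on f (fst H)" "f ` fst H \<subseteq> fst R" "\<And>x y. x \<in> fst H \<Longrightarrow> y \<in> fst H \<Longrightarrow> snd R (f x) (f y) \<longleftrightarrow> snd H x y"
    and H: "\<forall>x\<in>fst H. \<forall>y\<in>fst H. snd H x y \<longrightarrow>
      (\<exists>z\<in>fst H. (z = x \<or> snd H x z) \<and> z \<noteq> y \<and> \<not> snd H y z)"
  shows "inj_on (cl \<circ> f) (fst H)"
proof (rule inj_onI, rule ccontr)
  fix x y assume xy: "x \<in> fst H" "y \<in> fst H" "(cl \<circ> f) x = (cl \<circ> f) y" "x \<noteq> y"
  have symR: "snd R x y \<Longrightarrow> snd R y x" for x y using assms(1) unfolding is_graph_def by blast
  have fxy: "f x \<in> fst R" "f y \<in> fst R" "f x \<noteq> f y" using f xy unfolding inj_on_def by blast+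
  have a: "snd H x y" "snd H y x" using cl(1) fxy xy f(3) symR by (metis comp_apply)+
  have *: "\<not> closed_nbrs R (f p) \<subseteq> closed_nbrs R (f q)" if pq: "p \<in> fst H" "q \<in> fst H" "snd H p q" for p q
  proof -
    obtain z where z: "z \<in> fst H" "z = p \<or> snd H p z" "z \<noteq> q" "\<not> snd H q z" using H pq by blast
    then have "f z \<in> closed_nbrs R (f p)" using f(2,3) pq unfolding closed_nbrs_def nbrs_def by blast
    moreover have "f z \<noteq> f q" using z pq f(1) unfolding inj_on_def by blast
    then have "f z \<notin> closed_nbrs R (f q)" using f(3) z pq unfolding closed_nbrs_def nbrs_def by blast
    ultimately show ?thesis by blast
  qed
  show False using *[of x y] *[of y x] a xy cl(2)[OF fxy(1,2)] by auto
qed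

definition cyc5_adj :: "nat \<Rightarrow> nat \<Rightarrow> bool" where
  "cyc5_adj x y \<longleftrightarrow> y = (x + 1) mod 5 \<or> y = (x + 4) mod 5"

lemma no_4_cycle_in_cyc5:
  assumes "a < 5" "cyc5_adj a b" "cyc5_adj b c" "cyc5_adj a d" "cyc5_adj d c" "distinct [a, b, c, d]"
  shows False
  using assms unfolding less_5_cases cyc5_adj_def by auto

lemma crown_free:
  assumes g: "is_graph R" and c: "five_crown R"
  shows "free_of R two_P3" "free_of R (cycle_graph 4)" "free_of R (cycle_graph 6)"
    "free_of R (cycle_graph 7)" "free_of R three_pentagon"
proof -
  obtain X i where i: "i < 5" and rp: "ring_partition R X"
    and co: "complete_to R (X ((i + 4) mod 5)) (X ((i + 3) mod 5))" "complete_to R (X ((i + 1) mod 5)) (X ((i + 2) mod 5))"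
    using c unfolding five_crown_def by blast
  obtain cl where rc: "ring_class R X cl" using ring_class_exists[OF g rp] by blast
  note cl = ring_classD(1)[OF rc] and same = ring_classD(2)[OF rc] and comp = ring_classD(3)[OF rc]
    and adj = ring_classD(4)[OF rc]
  have symR: "snd R x y \<Longrightarrow> snd R y x" for x y using g unfolding is_graph_def by blast
  \<comment> \<open>More than five vertices cannot be placed injectively into five classes. C4 is
    small enough to fit, but would give a 4-cycle in C5. In \<open>two_P3\<close> a leaf's closed
    neighbourhood lies inside that of the middle vertex, so another argument is needed.\<close>
  have big: "free_of R H" if H: "\<forall>x\<in>fst H. \<forall>y\<in>fst H. snd H x y \<longrightarrow>
      (\<exists>z\<in>fst H. (z = x \<or> snd H x z) \<and> z \<noteq> y \<and> \<not> snd H y z)" "card (fst H) > 5" for H :: "nat graph"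
    unfolding free_of_def contains_induced_def
  proof
    assume "\<exists>f. inj_on f (fst H) \<and> f ` fst H \<subseteq> fst R \<and> (\<forall>x\<in>fst H. \<forall>y\<in>fst H. snd R (f x) (f y) = snd H x y)"
    then obtain f where f': "inj_on f (fst H)" "f ` fst H \<subseteq> fst R"
      "\<forall>x\<in>fst H. \<forall>y\<in>fst H. snd R (f x) (f y) = snd H x y" by blast
    note f = f'(1,2) f'(3)[rule_format]
    have "inj_on (cl \<circ> f) (fst H)" using ring_free_of_class_inj[OF g same comp f H(1)] .
    moreover have "(cl \<circ> f) ` fst H \<subseteq> {..<5}" using f(2) cl by auto
    ultimately have "card (fst H) \<le> card {..<5::nat}" by (rule card_inj_on_le) simp
    then show False using H(2) by simp
  qed
  show "free_of R (cycle_graph 6)" by (rule big) code_simp+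
  show "free_of R (cycle_graph 7)" by (rule big) code_simp+
  show "free_of R three_pentagon" by (rule big) code_simp+
  show "free_of R (cycle_graph 4)"
    unfolding free_of_def contains_induced_def
  proof
    let ?H = "cycle_graph 4"
    assume "\<exists>f. inj_on f (fst ?H) \<and> f ` fst ?H \<subseteq> fst R \<and> (\<forall>x\<in>fst ?H. \<forall>y\<in>fst ?H. snd R (f x) (f y) = snd ?H x y)"
    then obtain f where f': "inj_on f (fst ?H)" "f ` fst ?H \<subseteq> fst R"
      "\<forall>x\<in>fst ?H. \<forall>y\<in>fst ?H. snd R (f x) (f y) = snd ?H x y" by blast
    note f = f'(1,2) f'(3)[rule_format]
    have "\<forall>x\<in>fst ?H. \<forall>y\<in>fst ?H. snd ?H x y \<longrightarrow>
      (\<exists>z\<in>fst ?H. (z = x \<or> snd ?H x z) \<and> z \<noteq> y \<and> \<not> snd ?H y z)" by code_simp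
    then have inj: "inj_on (cl \<circ> f) (fst ?H)" using ring_free_of_class_inj[OF g same comp f] by blast
    have e: "snd R (f 0) (f 1)" "snd R (f 1) (f 2)" "snd R (f 0) (f 3)" "snd R (f 3) (f 2)"
      by (subst f(3); simp add: cycle_graph_def)+
    have "cl (f x) \<noteq> cl (f y)" if "x < 4" "y < 4" "x \<noteq> y" for x y
      using inj that unfolding inj_on_def cycle_graph_def by auto
    then have d: "distinct [cl (f 0), cl (f 1), cl (f 2), cl (f 3)]" by simp
    have "f 0 \<in> fst R" using f(2) by (auto simp: cycle_graph_def)
    then have "cl (f 0) < 5" using cl by blast
    then show False
      using no_4_cycle_in_cyc5[of "cl (f 0)" "cl (f 1)" "cl (f 2)" "cl (f 3)"] d
        adj[OF e(1)] adj[OF e(2)] adj[OF e(3)] adj[OF e(4)] unfolding cyc5_adj_def by auto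
  qed
  \<comment> \<open>The two complete pairs of a crown merge their classes, which leaves three
    cliques covering the ring.\<close>
  define part where "part v = (if cl v = i then 0 else if cl v = (i + 1) mod 5 \<or> cl v = (i + 2) mod 5 then 1 else 2::nat)" for v
  have pc: "part w = 0 \<and> cl w = i \<or> part w = 1 \<and> (cl w = (i + 1) mod 5 \<or> cl w = (i + 2) mod 5) \<or>
      part w = 2 \<and> (cl w = (i + 3) mod 5 \<or> cl w = (i + 4) mod 5)" if "w \<in> fst R" for w
  proof -
    have "cl w < 5" using cl that by blast
    then show ?thesis using mod5_cases[OF i, of "cl w"] unfolding part_def by presburger
  qed
  have part: "snd R u v" if "u \<in> fst R" "v \<in> fst R" "part u = part v" "u \<noteq> v" for u v
  proof (cases "cl u = cl v")
    case True then show ?thesis using same that by blast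
  next
    case False
    have "(cl u = (i + 1) mod 5 \<and> cl v = (i + 2) mod 5) \<or> (cl v = (i + 1) mod 5 \<and> cl u = (i + 2) mod 5) \<or>
      (cl u = (i + 3) mod 5 \<and> cl v = (i + 4) mod 5) \<or> (cl v = (i + 3) mod 5 \<and> cl u = (i + 4) mod 5)"
      using False that(3) pc[OF that(1)] pc[OF that(2)] by (elim disjE conjE) simp_all
    then show ?thesis
      using co cl[OF that(1)] cl[OF that(2)] symR unfolding complete_to_def by metis
  qed
  show "free_of R two_P3"
    unfolding free_of_def contains_induced_def
  proof
    let ?H = "two_P3"
    assume "\<exists>f. inj_on f (fst ?H) \<and> f ` fst ?H \<subseteq> fst R \<and> (\<forall>x\<in>fst ?H. \<forall>y\<in>fst ?H. snd R (f x) (f y) = snd ?H x y)"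
    then obtain f where f': "inj_on f (fst ?H)" "f ` fst ?H \<subseteq> fst R"
      "\<forall>x\<in>fst ?H. \<forall>y\<in>fst ?H. snd R (f x) (f y) = snd ?H x y" by blast
    note f = f'(1,2) f'(3)[rule_format]
    \<comment> \<open>The four leaves of the two paths form a stable set.\<close>
    have S: "{0, 2, 3, 5} \<subseteq> fst ?H" "\<forall>x\<in>{0, 2, 3, 5}. \<forall>y\<in>{0, 2, 3, 5}. \<not> snd ?H x y"
      by (auto simp: two_P3_def edges_graph_def)
    have "inj_on (part \<circ> f) {0, 2, 3, 5}"
    proof (rule inj_onI, rule ccontr)
      fix x y assume xy: "x \<in> {0, 2, 3, 5::nat}" "y \<in> {0, 2, 3, 5}" "(part \<circ> f) x = (part \<circ> f) y" "x \<noteq> y"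
      then have H: "x \<in> fst ?H" "y \<in> fst ?H" using S(1) by blast+
      then have "f x \<noteq> f y" using f(1) xy(4) unfolding inj_on_def by blast
      then have "snd R (f x) (f y)" using part[of "f x" "f y"] H f(2) xy(3) by auto
      then show False using f(3)[OF H] S(2) xy by blast
    qed
    moreover have "(part \<circ> f) ` {0, 2, 3, 5} \<subseteq> {..<3}" unfolding part_def by auto
    ultimately have "card {0, 2, 3, 5::nat} \<le> card {..<3::nat}" by (rule card_inj_on_le) simp
    then show False by simp
  qed
qed

section \<open>Adding universal vertices\<close>

lemma five_crown_nonempty: "five_crown R \<Longrightarrow> fst R \<noteq> {}"
  unfolding five_crown_def ring_partition_def by fastforce

lemma is_graph_induced:
  assumes "is_graph G" "S \<subseteq> fst G" "S \<noteq> {}"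
  shows "is_graph (induced G S)"
  using assms finite_subset unfolding is_graph_def induced_def by auto

text \<open>Vertices outside \<open>Q\<close> are universal, and \<open>H\<close> has no universal
  vertex, so a copy of \<open>H\<close> stays inside \<open>Q\<close>.\<close>

lemma free_of_add_universal:
  fixes H :: "nat graph"
  assumes g: "is_graph G" and cl: "is_clique G (fst G - Q)" and co: "complete_to G (fst G - Q) Q"
    and H: "\<forall>x\<in>fst H. \<exists>y\<in>fst H. y \<noteq> x \<and> \<not> snd H x y" and fr: "free_of (induced G Q) H"
  shows "free_of G H"
  unfolding free_of_def
proof
  assume "contains_induced G H"
  then obtain f where f: "inj_on f (fst H)" "f ` fst H \<subseteq> fst G"
    "\<forall>x\<in>fst H. \<forall>y\<in>fst H. snd G (f x) (f y) = snd H x y"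
    unfolding contains_induced_def by blast
  have fQ: "f x \<in> Q" if x: "x \<in> fst H" for x
  proof (rule ccontr)
    assume nQ: "f x \<notin> Q"
    obtain y where y: "y \<in> fst H" "y \<noteq> x" "\<not> snd H x y" using H x by blast
    have "f y \<noteq> f x" using f(1) x y(1,2) unfolding inj_on_def by blast
    moreover have "f x \<in> fst G - Q" "f y \<in> fst G" using f(2) nQ x y(1) by blast+
    ultimately have "snd G (f x) (f y)"
      using cl co unfolding is_clique_def complete_to_def by (cases "f y \<in> Q") auto
    then show False using f(3) x y by blast
  qed
  then have "contains_induced (induced G Q) H"
    unfolding contains_induced_def
    by (intro exI[of _ f]) (use f in \<open>auto simp: induced_def\<close>)
  then show False using fr unfolding free_of_def by blast
qed

lemma free_if_crown_plus_universal:
  assumes g: "is_graph G" and "crown_plus_universal G"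
  shows "free_of G two_P3" "free_of G (cycle_graph 4)" "free_of G (cycle_graph 6)"
    "free_of G (cycle_graph 7)" "free_of G three_pentagon" "\<forall>v\<in>fst G. \<not> simplicial G v"
proof -
  obtain Q where Q: "Q \<subseteq> fst G" "five_crown (induced G Q)" "is_clique G (fst G - Q)"
    "complete_to G (fst G - Q) Q"
    using assms(2) unfolding crown_plus_universal_def by blast
  have fQ: "fst (induced G Q) = Q" unfolding induced_def by simp
  have gQ: "is_graph (induced G Q)"
    using is_graph_induced[OF g Q(1)] five_crown_nonempty[OF Q(2)] fQ by simp
  note fr = crown_free[OF gQ Q(2)]
  note up = free_of_add_universal[OF g Q(3,4)]
  show "free_of G two_P3" by (rule up[OF _ fr(1)]) code_simp
  show "free_of G (cycle_graph 4)" by (rule up[OF _ fr(2)]) code_simp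
  show "free_of G (cycle_graph 6)" by (rule up[OF _ fr(3)]) code_simp
  show "free_of G (cycle_graph 7)" by (rule up[OF _ fr(4)]) code_simp
  show "free_of G three_pentagon" by (rule up[OF _ fr(5)]) code_simp
  obtain X where "ring_partition (induced G Q) X" using Q(2) unfolding five_crown_def by blast
  then obtain c where c: "ring_class (induced G Q) X c" using ring_class_exists[OF gQ] by blast
  note cD = ring_classD[OF c, unfolded fQ]
  have "\<exists>x y. snd G v x \<and> snd G v y \<and> x \<noteq> y \<and> \<not> snd G x y" if v: "v \<in> fst G" for v
  proof -
    \<comment> \<open>The heads of classes \<open>i + 1\<close> and \<open>i + 4\<close> are
      nonadjacent common neighbours of \<open>v\<close>. For \<open>v\<close> outside
      \<open>Q\<close> any index would do, since \<open>v\<close> is complete to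
      \<open>Q\<close>.\<close>
    define i where "i = (if v \<in> Q then c v else 0)"
    have i: "i < 5" using cD(1) unfolding i_def by simp
    have m: "(i + 1) mod 5 < 5" "(i + 4) mod 5 < 5" by simp_all
    obtain x where x: "x \<in> Q" "c x = (i + 1) mod 5"
      "\<forall>w\<in>Q. c w = (c x + 1) mod 5 \<or> c w = (c x + 4) mod 5 \<longrightarrow> snd (induced G Q) x w"
      using cD(5)[OF m(1)] by metis
    obtain y where y: "y \<in> Q" "c y = (i + 4) mod 5"
      "\<forall>w\<in>Q. c w = (c y + 1) mod 5 \<or> c w = (c y + 4) mod 5 \<longrightarrow> snd (induced G Q) y w"
      using cD(5)[OF m(2)] by metis
    have ne: "c y \<noteq> c x" "c y \<noteq> (c x + 1) mod 5" "c y \<noteq> (c x + 4) mod 5"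
      using x(2) y(2) i unfolding less_5_cases by auto
    then have "x \<noteq> y" "\<not> snd (induced G Q) x y" using cD(4)[of x y] by auto
    moreover have "snd G v x \<and> snd G v y"
    proof (cases "v \<in> Q")
      case True
      then have "c v = i" unfolding i_def by simp
      moreover have "i = (c x + 4) mod 5" "i = (c y + 1) mod 5"
        using x(2) y(2) i unfolding less_5_cases by auto
      ultimately have "snd (induced G Q) x v" "snd (induced G Q) y v" using x(3) y(3) True by simp_all
      then show ?thesis using g unfolding induced_def is_graph_def by auto
    next
      case False
      then show ?thesis using v x(1) y(1) Q(4) unfolding complete_to_def by blast
    qed
    ultimately show ?thesis using x(1) y(1) unfolding induced_def by auto
  qed
  note nonadjacent = this
  show "\<forall>v\<in>fst G. \<not> simplicial G v"
  proof (intro ballI notI)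
    fix v assume v: "v \<in> fst G" "simplicial G v"
    obtain x y where xy: "snd G v x" "snd G v y" "x \<noteq> y" "\<not> snd G x y"
      using nonadjacent[OF v(1)] by blast
    have "x \<in> fst G" "y \<in> fst G" using g xy(1,2) unfolding is_graph_def by blast+
    then show False using v(2) xy unfolding simplicial_def is_clique_def nbrs_def by blast
  qed
qed

section \<open>Anticomponents\<close>

text \<open>Classes two apart are anticomplete, and steps of two generate the integers mod 5.
  \<open>reach\<close> takes at least one step, so two vertices of the same class are joined by
  going around.\<close>

lemma anticonnected_ring:
  assumes g: "is_graph (induced G Q)" and rp: "ring_partition (induced G Q) X" and Q: "Q \<subseteq> fst G"
  shows "anticonnected G Q"
proof -
  have fQ: "fst (induced G Q) = Q" unfolding induced_def by simp
  obtain c where c: "ring_class (induced G Q) X c" using ring_class_exists[OF g rp] by blast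
  note cD = ring_classD[OF c, unfolded fQ]
  let ?r = "\<lambda>u v. u \<in> Q \<and> v \<in> Q \<and> u \<noteq> v \<and> \<not> snd G u v"
  have r: "?r u v" if "u \<in> Q" "v \<in> Q" "c v = (c u + 2) mod 5" for u v
  proof -
    have "c u < 5" using cD(1) that by blast
    then have ne: "c v \<noteq> c u" "c v \<noteq> (c u + 1) mod 5" "c v \<noteq> (c u + 4) mod 5"
      using that(3) unfolding less_5_cases by auto
    then have "\<not> snd (induced G Q) u v" using cD(4) by blast
    then show ?thesis using that ne unfolding induced_def by auto
  qed
  have reach: "?r\<^sup>*\<^sup>* u v" if "u \<in> Q" "v \<in> Q" "c v = (c u + 2 * Suc n) mod 5" for u v n
    using that
  proof (induction n arbitrary: v)
    case 0
    then show ?case using r[of u v] by auto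
  next
    case (Suc n)
    have "(c u + 2 * Suc n) mod 5 < 5" by simp
    then obtain w where w: "w \<in> Q" "c w = (c u + 2 * Suc n) mod 5" using cD(5) by metis
    have "c v = (c w + 2) mod 5" using Suc.prems(3) w(2) by (simp add: mod_simps)
    then show ?case using Suc.IH[OF Suc.prems(1) w] r[OF w(1) Suc.prems(2)]
      by (simp add: rtranclp.rtrancl_into_rtrancl)
  qed
  have "?r\<^sup>*\<^sup>* u v" if "u \<in> Q" "v \<in> Q" for u v
  proof -
    \<comment> \<open>The number of steps must be 3 times \<open>c v - c u\<close> mod 5, as 3
      inverts 2. Writing -3 as 2 and adding 5 avoids subtraction and keeps it positive.\<close>
    have "c u + 2 * Suc (4 + 3 * c v + 2 * c u) = c v + 5 * (2 + c v + c u)" by simp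
    moreover have "c v < 5" using cD(1) that(2) by blast
    ultimately have "c v = (c u + 2 * Suc (4 + 3 * c v + 2 * c u)) mod 5"
      by (metis mod_less mod_mult_self2)
    then show ?thesis by (rule reach[OF that])
  qed
  moreover have "Q \<noteq> {}" using g fQ unfolding is_graph_def by simp
  ultimately show ?thesis using Q unfolding anticonnected_def by blast
qed

lemma anticonnected_no_universal:
  assumes "anticonnected G T" "t \<in> T" "u \<in> T" "t \<noteq> u"
  shows "\<exists>w\<in>T. w \<noteq> t \<and> \<not> snd G t w"
proof -
  have "(\<lambda>u v. u \<in> T \<and> v \<in> T \<and> u \<noteq> v \<and> \<not> snd G u v)\<^sup>*\<^sup>* t u"
    using assms unfolding anticonnected_def by blast
  then show ?thesis using assms(4) by (cases rule: converse_rtranclpE) auto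
qed

lemma anticomponent_if_crown_plus_universal:
  assumes g: "is_graph G" and "crown_plus_universal G"
  shows "(\<exists>!S. nontrivial_anticomponent G S) \<and>
    (\<forall>S. nontrivial_anticomponent G S \<longrightarrow> five_crown (induced G S))"
proof -
  obtain Q where Q: "Q \<subseteq> fst G" "five_crown (induced G Q)" "is_clique G (fst G - Q)"
    "complete_to G (fst G - Q) Q"
    using assms(2) unfolding crown_plus_universal_def by blast
  have fQ: "fst (induced G Q) = Q" unfolding induced_def by simp
  have gQ: "is_graph (induced G Q)"
    using is_graph_induced[OF g Q(1)] five_crown_nonempty[OF Q(2)] fQ by simp
  have finG: "finite (fst G)" using g unfolding is_graph_def by blast
  obtain X where X: "ring_partition (induced G Q) X" using Q(2) unfolding five_crown_def by blast
  have aQ: "anticonnected G Q" using anticonnected_ring[OF gQ X Q(1)] .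
  \<comment> \<open>A vertex outside \<open>Q\<close> is universal, but no vertex of an
    anticonnected set with two elements is universal in it. Hence \<open>Q\<close> is the largest
    such set.\<close>
  have sub: "T \<subseteq> Q" if T: "anticonnected G T" "t \<in> T" "u \<in> T" "t \<noteq> u" for T t u
  proof
    fix w assume w: "w \<in> T"
    show "w \<in> Q"
    proof (rule ccontr)
      assume "w \<notin> Q"
      moreover obtain z where z: "z \<in> T" "z \<noteq> w" "\<not> snd G w z"
        using anticonnected_no_universal[OF T(1) w] T by metis
      moreover have "T \<subseteq> fst G" using T(1) unfolding anticonnected_def by blast
      ultimately have wz: "w \<in> fst G - Q" "z \<in> fst G" "z \<noteq> w" "\<not> snd G w z" using w by blast+
      have "snd G w z"
      proof (cases "z \<in> Q")
        case True
        then show ?thesis using Q(4) wz(1) unfolding complete_to_def by blast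
      next
        case False
        then have "z \<in> fst G - Q" using wz(2) by simp
        then show ?thesis
          using Q(3)[unfolded is_clique_def, THEN conjunct2, rule_format, OF wz(1)] wz(3) by simp
      qed
      then show False using wz(4) by blast
    qed
  qed
  obtain c where c: "ring_class (induced G Q) X c" using ring_class_exists[OF gQ X] by blast
  obtain x y where "x \<in> Q" "c x = 0" "y \<in> Q" "c y = 1"
    using ring_classD(5)[OF c, of 0] ring_classD(5)[OF c, of 1] unfolding fQ by auto
  then have xy: "x \<in> Q" "y \<in> Q" "x \<noteq> y" by auto
  have finQ: "finite Q" using finite_subset[OF Q(1) finG] .
  have "card {x, y} \<le> card Q" using card_mono[OF finQ, of "{x, y}"] xy(1,2) by blast
  then have "card Q \<ge> 2" using xy(3) by simp
  moreover have "\<not> anticonnected G T" if T: "Q \<subset> T" for T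
  proof
    assume "anticonnected G T"
    moreover have "x \<in> T" "y \<in> T" using T xy by blast+
    ultimately have "T \<subseteq> Q" using xy(3) by (rule sub)
    then show False using T by blast
  qed
  ultimately have nQ: "nontrivial_anticomponent G Q"
    using aQ unfolding nontrivial_anticomponent_def anticomponent_def by blast
  have "S = Q" if S: "nontrivial_anticomponent G S" for S
  proof -
    have aS: "anticonnected G S" and cS: "card S \<ge> 2"
      using S unfolding nontrivial_anticomponent_def anticomponent_def by blast+
    obtain t where t: "t \<in> S" using aS unfolding anticonnected_def by blast
    have "S \<noteq> {t}" using cS by auto
    then obtain u where "u \<in> S" "t \<noteq> u" using t by blast
    then have "S \<subseteq> Q" using sub[OF aS t] by blast
    then show ?thesis
      using S aQ Q(1) unfolding nontrivial_anticomponent_def anticomponent_def by blast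
  qed
  then show ?thesis using nQ Q(2) by metis
qed

text \<open>A nonedge at a vertex \<open>v\<close> outside \<open>S\<close> would be an
  anticonnected pair; a maximal anticonnected set containing it is a second nontrivial
  anticomponent. So all vertices outside \<open>S\<close> are universal.\<close>

lemma crown_plus_universal_if_anticomponent:
  assumes g: "is_graph G" and ex: "\<exists>!S. nontrivial_anticomponent G S"
    and cr: "\<forall>S. nontrivial_anticomponent G S \<longrightarrow> five_crown (induced G S)"
  shows "crown_plus_universal G"
proof -
  obtain S where S: "nontrivial_anticomponent G S" and uniq: "\<And>T. nontrivial_anticomponent G T \<Longrightarrow> T = S"
    using ex by blast
  have finG: "finite (fst G)" using g unfolding is_graph_def by blast
  have symG: "snd G x y \<Longrightarrow> snd G y x" for x y using g unfolding is_graph_def by blast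
  have SG: "S \<subseteq> fst G"
    using S unfolding nontrivial_anticomponent_def anticomponent_def anticonnected_def by blast
  have univ: "snd G v w" if vw: "v \<in> fst G - S" "w \<in> fst G" "w \<noteq> v" for v w
  proof (rule ccontr)
    assume n: "\<not> snd G v w"
    let ?A = "{T. anticonnected G T \<and> {v, w} \<subseteq> T}"
    let ?r = "\<lambda>x y. x \<in> {v, w} \<and> y \<in> {v, w} \<and> x \<noteq> y \<and> \<not> snd G x y"
    have "?r v w" "?r w v" using n vw(3) symG by auto
    then have "anticonnected G {v, w}" using vw unfolding anticonnected_def by auto
    moreover have fin: "finite ?A"
      by (rule finite_subset[of _ "Pow (fst G)"]) (use finG in \<open>auto simp: anticonnected_def\<close>)
    ultimately obtain T where T: "T \<in> ?A" "{v, w} \<subseteq> T" "\<forall>T'\<in>?A. T \<subseteq> T' \<longrightarrow> T' = T"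
      using finite_has_maximal2[OF fin, of "{v, w}"] by auto
    have "\<not> anticonnected G T'" if "T \<subset> T'" for T' using T(2,3) that by blast
    then have "anticomponent G T" unfolding anticomponent_def using T(1) by blast
    moreover have "T \<subseteq> fst G" using T(1) unfolding anticonnected_def by blast
    then have "finite T" using finG finite_subset by blast
    then have "card {v, w} \<le> card T" using T(2) by (rule card_mono)
    then have "card T \<ge> 2" using vw(3) by simp
    ultimately have "T = S" using uniq unfolding nontrivial_anticomponent_def by blast
    then show False using T(2) vw(1) by blast
  qed
  have "complete_to G (fst G - S) S" using univ SG unfolding complete_to_def by blast
  moreover have "is_clique G (fst G - S)" using univ unfolding is_clique_def by blast
  ultimately show ?thesis using SG cr S unfolding crown_plus_universal_def by blast
qed

text \<open>The second conjunct of (b) quantifies over all nontrivial anticomponents, which by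
  uniqueness means the only one. Both (a) and (b) are shown equivalent to (c).\<close>

theorem theorem6p9:
  fixes G :: "'a graph"
  assumes "is_graph G"
  shows "((free_of G two_P3 \<and> free_of G (cycle_graph 4) \<and> free_of G (cycle_graph 6) \<and>
           free_of G (cycle_graph 7) \<and> free_of G three_pentagon \<and>
           (\<forall>v\<in>fst G. \<not> simplicial G v))
          \<longleftrightarrow> (\<exists>!S. nontrivial_anticomponent G S) \<and>
              (\<forall>S. nontrivial_anticomponent G S \<longrightarrow> five_crown (induced G S)))
       \<and> ((\<exists>!S. nontrivial_anticomponent G S) \<and>
              (\<forall>S. nontrivial_anticomponent G S \<longrightarrow> five_crown (induced G S))
          \<longleftrightarrow> crown_plus_universal G)"
proof -
  let ?a = "free_of G two_P3 \<and> free_of G (cycle_graph 4) \<and> free_of G (cycle_graph 6) \<and>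
           free_of G (cycle_graph 7) \<and> free_of G three_pentagon \<and> (\<forall>v\<in>fst G. \<not> simplicial G v)"
  let ?b = "(\<exists>!S. nontrivial_anticomponent G S) \<and>
              (\<forall>S. nontrivial_anticomponent G S \<longrightarrow> five_crown (induced G S))"
  let ?c = "crown_plus_universal G"
  have "?a \<Longrightarrow> ?c" using crown_plus_universal_if_free[OF assms] by simp
  moreover have "?c \<Longrightarrow> ?a" using free_if_crown_plus_universal[OF assms] by simp
  moreover have "?c \<Longrightarrow> ?b" by (rule anticomponent_if_crown_plus_universal[OF assms])
  moreover have "?b \<Longrightarrow> ?c" using crown_plus_universal_if_anticomponent[OF assms] by simp
  ultimately show ?thesis by argo
qed

end
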